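(* Let $k\ge1$ be an integer and let $g_k:\mathbb{C}\setminus[1,\infty)\to\mathbb{C}$ be the function $$g_k(\varsigma):=(\sqrt{1-\varsigma})^{k+1}\sum_{f=1}^\infty f^k\frac{b(\varsigma)^f}{1-b(\varsigma)^f},\qquad b(\varsigma):=\frac{1-\sqrt{1-\varsigma}}{1+\sqrt{1-\varsigma}}.$$ Then for every integer $M\ge2$ there are constants $\lambda_l(k),\tilde\lambda_l(k)$ ($l=1,\dots,M$) such that the function $\wp_k:U_1(0)\to\mathbb{C}$, $$\wp_k(\varsigma):=g_k(\varsigma)-\frac{k!\,\zeta(k+1)}{2^{k+1}}+\sum_{l=1}^M\lambda_l(k)(1-\varsigma)^l+\delta_{k,1}\sqrt{1-\varsigma}\left(\frac14+\sum_{l=1}^M\tilde\lambda_l(k)(1-\varsigma)^l\right),$$ together with its derivatives in $\varsigma$ up to order $M$, has a continuous continuation onto $\bar U_1(0)$ which is $0$ at $\varsigma=1$ in all these orders (i.e. the continuations of $\wp_k$ and of its derivatives up to order $M$ all vanish at $\varsigma=1$).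
   Context: $U_1(0)=\{\varsigma\in\mathbb{C}:|\varsigma|<1\}$ and $\bar U_1(0)=\{\varsigma\in\mathbb{C}:|\varsigma|\le1\}$. $\sqrt{\ \cdot\ }$ denotes the branch of the square root on $\mathbb{C}\setminus(-\infty,0]$ which is positive on the positive real axis. $\zeta$ is the Riemann zeta function and $\delta_{k,1}$ is the Kronecker symbol. *)

theory Defs
  imports "HOL-Complex_Analysis.Complex_Analysis"
begin

text \<open>
  The Riemann zeta function on its half-plane of absolute convergence; outside \<open>Re s > 1\<close> this
  is not the analytic continuation. It is only evaluated at the integers \<open>k + 1 \<ge> 2\<close>.
\<close>

definition zeta :: "complex \<Rightarrow> complex" where
  "zeta s = (\<Sum>n. 1 / of_nat (Suc n) powr s)"

definition b :: "complex \<Rightarrow> complex" where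
  "b z = (1 - csqrt (1 - z)) / (1 + csqrt (1 - z))"

text \<open>
  The domain of \<open>g k\<close> is the complex plane without \<open>[1, \<infinity>)\<close>. There \<open>csqrt (1 - z)\<close> has positive
  real part, so \<open>norm (b z) < 1\<close> and the series converges. Values on \<open>[1, \<infinity>)\<close> are not meaningful.
\<close>

definition g :: "nat \<Rightarrow> complex \<Rightarrow> complex" where
  "g k z = csqrt (1 - z) ^ (k + 1) *
     (\<Sum>n. of_nat (Suc n) ^ k * (b z ^ Suc n / (1 - b z ^ Suc n)))"

definition wp :: "nat \<Rightarrow> nat \<Rightarrow> (nat \<Rightarrow> complex) \<Rightarrow> (nat \<Rightarrow> complex) \<Rightarrow> complex \<Rightarrow> complex" where
  "wp k M lam lam' z =
     g k z - fact k * zeta (of_nat (k + 1)) / 2 ^ (k + 1)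
     + (\<Sum>l=1..M. lam l * (1 - z) ^ l)
     + of_bool (k = 1) * csqrt (1 - z) * (1 / 4 + (\<Sum>l=1..M. lam' l * (1 - z) ^ l))"

end

theory Submission
  imports Defs "HOL-Real_Asymp.Real_Asymp"
begin

text \<open>
  Put \<open>w = \<surd>(1 - z)\<close> and \<open>t = ln ((1 + w) / (1 - w))\<close>, so that \<open>b z = e\<^sup>-\<^sup>t\<close>. Expanding the geometric
  series turns the Lambert series into \<open>\<Sum>n\<ge>1. G (n t)\<close> with
  \<open>G x = (-1)\<^sup>k D\<^sup>k (1 / (e\<^sup>x - 1)) = k! / x\<^sup>k\<^sup>+\<^sup>1 + (-1)\<^sup>k D\<^sup>k h x\<close>, where \<open>h x = 1 / (e\<^sup>x - 1) - 1 / x\<close> is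
  analytic at \<open>0\<close>. The first part sums to \<open>k! \<zeta>(k + 1) / t\<^sup>k\<^sup>+\<^sup>1\<close>; Euler--Maclaurin summation, uniform in a
  sector, expands the second part in powers of \<open>t\<close> with coefficients \<open>D\<^sup>j h 0\<close>. Since \<open>h + 1/2\<close> is
  odd and \<open>t / w\<close> is an even function of \<open>w\<close>, all terms of \<open>g\<close> are analytic in \<open>w\<^sup>2 = 1 - z\<close>, apart from
  the one with \<open>h 0 = -1/2\<close>, which occurs only for \<open>k = 1\<close>. Cauchy's estimate on discs whose
  radius is proportional to \<open>|1 - z|\<close> transfers the error bound to the derivatives.
\<close>

section \<open>Euler--Maclaurin summation in a sector\<close>

text \<open>\<open>bern p\<close> is the Bernoulli number \<open>B\<^sub>p\<close> divided by \<open>p!\<close>.\<close>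

fun bern :: "nat \<Rightarrow> complex" where
  "bern p = of_bool (p = 0) - (\<Sum>m<p. bern m / fact (Suc p - m))"

declare bern.simps [simp del]

lemma bern_0: "bern 0 = 1"
  by (subst bern.simps) simp

text \<open>Comparison of coefficients in (t / (e^t - 1)) * ((e^t - 1) / t) = 1, with
  \<open>bern\<close> as the coefficients of the first factor.\<close>

lemma bern_convolution: "(\<Sum>m\<le>p. bern m / fact (Suc p - m)) = of_bool (p = 0)"
proof -
  have "(\<Sum>m\<le>p. bern m / fact (Suc p - m)) = bern p + (\<Sum>m<p. bern m / fact (Suc p - m))"
    by (simp add: lessThan_Suc_atMost [symmetric] del: fact_Suc)
  also have "bern p = of_bool (p = 0) - (\<Sum>m<p. bern m / fact (Suc p - m))"
    by (rule bern.simps)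
  finally show ?thesis
    by simp
qed

text \<open>The slope 2 leaves room above the slope 7/4 of \<open>csqrt_wedge\<close>, so that
  multiplication by a number close to 2 stays inside. The sector is closed and contains 0, the
  starting point of the summation.\<close>

definition sector :: "complex set" where
  "sector = {z. \<bar>Im z\<bar> \<le> 2 * Re z}"

lemma Re_pos_sector: "z \<in> sector \<Longrightarrow> z \<noteq> 0 \<Longrightarrow> 0 < Re z"
  by (auto simp: sector_def complex_eq_iff)

lemma norm_le_sector: "z \<in> sector \<Longrightarrow> norm z \<le> 3 * Re z"
  using cmod_le [of z] by (auto simp: sector_def)

lemma scale_sector: "z \<in> sector \<Longrightarrow> 0 \<le> r \<Longrightarrow> of_real r * z \<in> sector"
  by (auto simp: sector_def abs_mult mult.left_commute mult_left_mono)

text \<open>A Riemann sum of 1 / (1 + s)^2, dominated after a shift by the telescoping differences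
  of 1 / (1 + n x); the term \<open>n = 0\<close> adds at most 1. The bound 2 does not depend on
  \<open>x\<close>, which makes the error in the summation formula uniform.\<close>

lemma sum_decay_bound:
  fixes x :: real
  assumes "0 < x" "x \<le> 1"
  shows "summable (\<lambda>n. x / (1 + real n * x)\<^sup>2)"
    and "(\<Sum>n. x / (1 + real n * x)\<^sup>2) \<le> 2"
proof -
  define d where "d n = 1 / (1 + real n * x)" for n
  have pos: "1 + real n * x > 0" for n
    using assms by (auto intro: add_pos_nonneg)
  have "d \<longlonglongrightarrow> 0"
    unfolding d_def using assms by real_asymp
  from telescope_sums' [OF this] have tel: "(\<lambda>n. d n - d (Suc n)) sums 1"
    by (simp add: d_def)
  have le: "x / (1 + real (Suc n) * x)\<^sup>2 \<le> d n - d (Suc n)" for n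
  proof -
    have "d n - d (Suc n) = x / ((1 + real n * x) * (1 + real (Suc n) * x))"
      using pos [of n] pos [of "Suc n"] by (simp add: d_def field_simps)
    moreover have "(1 + real n * x) * (1 + real (Suc n) * x) \<le> (1 + real (Suc n) * x)\<^sup>2"
      unfolding power2_eq_square using pos [of "Suc n"] assms
      by (intro mult_right_mono) (auto simp: algebra_simps)
    ultimately show ?thesis
      using assms pos [of n] pos [of "Suc n"] by (auto intro!: divide_left_mono)
  qed
  have sm: "summable (\<lambda>n. x / (1 + real (Suc n) * x)\<^sup>2)"
    by (rule summable_comparison_test' [of "\<lambda>n. d n - d (Suc n)" 0])
       (use tel le assms in \<open>auto simp: sums_iff\<close>)
  then show sm0: "summable (\<lambda>n. x / (1 + real n * x)\<^sup>2)"
    by (subst summable_Suc_iff [symmetric])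
  have "(\<Sum>n. x / (1 + real (Suc n) * x)\<^sup>2) \<le> 1"
    using suminf_le [OF le sm] tel by (simp add: sums_iff)
  with suminf_split_head [OF sm0] assms show "(\<Sum>n. x / (1 + real n * x)\<^sup>2) \<le> 2"
    by simp
qed

text \<open>The segment from \<open>n * t\<close> to \<open>(n + 1) * t\<close> lies on a ray of the
  sector on which the norm increases, so the decay bound at its left end controls the whole
  remainder.\<close>

lemma Taylor_along_sector:
  fixes F :: "nat \<Rightarrow> complex \<Rightarrow> complex"
  assumes deriv: "\<And>j z. z \<in> sector \<Longrightarrow> (F j has_field_derivative F (Suc j) z) (at z)"
    and bound: "\<And>z. z \<in> sector \<Longrightarrow> norm (F (Suc q) z) \<le> C / (1 + norm z)\<^sup>2"
    and C: "C \<ge> 0" and t: "t \<in> sector" and jq: "j \<le> q"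
  shows "norm (F j (of_nat (Suc n) * t) - (\<Sum>i\<le>q - j. F (j + i) (of_nat n * t) * t ^ i / fact i))
           \<le> norm t ^ Suc (q - j) * (C / (1 + real n * norm t)\<^sup>2)"
proof -
  define S where "S = closed_segment (of_nat n * t) (of_nat (Suc n) * t)"
  have seg: "z \<in> sector \<and> norm z \<ge> real n * norm t" if "z \<in> S" for z
  proof -
    from that obtain s where s: "0 \<le> s" "s \<le> 1"
      "z = (1 - s) *\<^sub>R (of_nat n * t) + s *\<^sub>R (of_nat (Suc n) * t)"
      by (auto simp: S_def closed_segment_def)
    then have z: "z = of_real (real n + s) * t"
      by (simp add: scaleR_conv_of_real algebra_simps)
    show ?thesis
      unfolding z using s t by (auto simp: scale_sector norm_mult mult_right_mono simp del: of_real_add)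
  qed
  have "norm (F (j + 0) (of_nat (Suc n) * t)
         - (\<Sum>i\<le>q - j. F (j + i) (of_nat n * t) * (of_nat (Suc n) * t - of_nat n * t) ^ i / fact i))
         \<le> C / (1 + real n * norm t)\<^sup>2 * norm (of_nat (Suc n) * t - of_nat n * t) ^ Suc (q - j)
             / fact (q - j)"
  proof (rule complex_Taylor [of S "q - j" "\<lambda>i. F (j + i)"])
    show "(F (j + i) has_field_derivative F (j + Suc i) x) (at x within S)" if "x \<in> S" for i x
      using deriv [of x "j + i"] seg [OF that] by (simp add: has_field_derivative_at_within)
    show "norm (F (j + Suc (q - j)) x) \<le> C / (1 + real n * norm t)\<^sup>2" if "x \<in> S" for x
    proof -
      have "norm (F (Suc q) x) \<le> C / (1 + norm x)\<^sup>2"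
        using bound seg [OF that] by blast
      also have "\<dots> \<le> C / (1 + real n * norm t)\<^sup>2"
        using seg [OF that] C
        by (intro divide_left_mono power_mono mult_pos_pos zero_less_power)
           (auto intro!: add_pos_nonneg)
      finally show ?thesis
        using jq by simp
    qed
  qed (auto simp: S_def)
  also have "of_nat (Suc n) * t - of_nat n * t = t"
    by (simp add: algebra_simps)
  also have "C / (1 + real n * norm t)\<^sup>2 * norm t ^ Suc (q - j) / fact (q - j)
      \<le> C / (1 + real n * norm t)\<^sup>2 * norm t ^ Suc (q - j) / 1"
    using C by (intro divide_left_mono) auto
  finally show ?thesis
    by (simp add: mult.commute)
qed

text \<open>Each \<open>F m\<close> is expanded at \<open>n * t\<close> up to derivative order
  \<open>N\<close>. Collected by derivative order, the coefficients are the convolutions of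
  \<open>bern_convolution\<close>; only \<open>t * F 1\<close> survives, and the Taylor remainders
  give the error.\<close>

lemma Euler_Maclaurin_step:
  fixes F :: "nat \<Rightarrow> complex \<Rightarrow> complex"
  assumes deriv: "\<And>j z. z \<in> sector \<Longrightarrow> (F j has_field_derivative F (Suc j) z) (at z)"
    and bound: "\<And>z. z \<in> sector \<Longrightarrow> norm (F (Suc N) z) \<le> C / (1 + norm z)\<^sup>2"
    and C: "C \<ge> 0" and t: "t \<in> sector" and N: "N > 0"
  defines "E \<equiv> \<lambda>z. \<Sum>m<N. bern m * t ^ m * F m z"
  shows "norm (E (of_nat (Suc n) * t) - E (of_nat n * t) - t * F 1 (of_nat n * t))
           \<le> (\<Sum>m<N. norm (bern m)) * norm t ^ N * (norm t * (C / (1 + real n * norm t)\<^sup>2))"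
proof -
  define z where "z = of_nat n * t"
  define z' where "z' = of_nat (Suc n) * t"
  define R where "R m = F m z' - (\<Sum>i\<le>N - m. F (m + i) z * t ^ i / fact i)" for m
  have R: "norm (R m) \<le> norm t ^ Suc (N - m) * (C / (1 + real n * norm t)\<^sup>2)" if "m < N" for m
    unfolding R_def z_def z'_def
    by (rule Taylor_along_sector [OF deriv bound C t]) (use that in auto)
  have "E z' - E z = (\<Sum>m<N. bern m * t ^ m * (\<Sum>i=1..N - m. F (m + i) z * t ^ i / fact i))
          + (\<Sum>m<N. bern m * t ^ m * R m)"
  proof -
    have "(\<Sum>i\<le>N - m. F (m + i) z * t ^ i / fact i)
        = F m z + (\<Sum>i=1..N - m. F (m + i) z * t ^ i / fact i)" for m
      by (simp add: atMost_atLeast0 sum.atLeast_Suc_atMost)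
    then have "F m z' = F m z + (\<Sum>i=1..N - m. F (m + i) z * t ^ i / fact i) + R m" for m
      by (simp add: R_def)
    then show ?thesis
      by (simp add: E_def sum_subtractf [symmetric] sum.distrib [symmetric] algebra_simps)
  qed
  also have "(\<Sum>m<N. bern m * t ^ m * (\<Sum>i=1..N - m. F (m + i) z * t ^ i / fact i))
      = (\<Sum>m<N. \<Sum>p\<in>{m..<N}. t ^ Suc p * F (Suc p) z * (bern m / fact (Suc p - m)))"
  proof (rule sum.cong [OF refl])
    fix m assume m: "m \<in> {..<N}"
    show "bern m * t ^ m * (\<Sum>i=1..N - m. F (m + i) z * t ^ i / fact i)
        = (\<Sum>p\<in>{m..<N}. t ^ Suc p * F (Suc p) z * (bern m / fact (Suc p - m)))"
      unfolding sum_distrib_left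
      by (rule sum.reindex_bij_witness [of _ "\<lambda>p. Suc p - m" "\<lambda>i. m + i - 1"])
         (use m in \<open>auto simp flip: power_add power_Suc simp del: fact_Suc\<close>)
  qed
  \<comment> \<open>The triangle \<open>m \<le> p < N\<close> is summed with \<open>p\<close>
    outside, so that the inner sum is a convolution.\<close>
  also have "\<dots> = (\<Sum>p<N. \<Sum>m\<le>p. t ^ Suc p * F (Suc p) z * (bern m / fact (Suc p - m)))"
    by (subst sum.Sigma, simp, simp, subst sum.Sigma, simp, simp,
        rule sum.reindex_bij_witness [of _ "\<lambda>(x,y). (y,x)" "\<lambda>(x,y). (y,x)"]) auto
  also have "\<dots> = (\<Sum>p<N. t ^ Suc p * F (Suc p) z * of_bool (p = 0))"
    by (simp only: sum_distrib_left [symmetric] bern_convolution)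
  also have "\<dots> = t * F 1 z"
    using N by (cases N) (simp_all add: sum.lessThan_Suc_shift del: sum.lessThan_Suc)
  finally have "E z' - E z - t * F 1 z = (\<Sum>m<N. bern m * t ^ m * R m)"
    by simp
  also have "norm \<dots> \<le> (\<Sum>m<N. norm (bern m) * (norm t ^ Suc N * (C / (1 + real n * norm t)\<^sup>2)))"
  proof (rule sum_norm_le)
    fix m assume "m \<in> {..<N}"
    then have m: "m < N" by simp
    have "norm (bern m * t ^ m * R m)
        \<le> norm (bern m) * norm t ^ m * (norm t ^ Suc (N - m) * (C / (1 + real n * norm t)\<^sup>2))"
      unfolding norm_mult norm_power by (intro mult_left_mono R m) auto
    also have "\<dots> = norm (bern m) * (norm t ^ (m + Suc (N - m)) * (C / (1 + real n * norm t)\<^sup>2))"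
      by (simp only: power_add ac_simps)
    finally show "norm (bern m * t ^ m * R m)
        \<le> norm (bern m) * (norm t ^ Suc N * (C / (1 + real n * norm t)\<^sup>2))"
      using m by simp
  qed
  finally show ?thesis
    unfolding z_def z'_def sum_distrib_right
    by (simp only: mult_ac times_divide_eq_left times_divide_eq_right power_Suc)
qed

text \<open>
  \<open>E z = \<Sum>m<N. bern m t\<^sup>m F\<^sub>m z\<close> satisfies \<open>E (z + t) - E z = t F\<^sub>1 z\<close> up to an error of order \<open>N + 1\<close> in \<open>t\<close>;
  summing over \<open>z = n t\<close> telescopes.
\<close>

proposition Euler_Maclaurin_sector:
  fixes F :: "nat \<Rightarrow> complex \<Rightarrow> complex"
  assumes deriv: "\<And>j z. z \<in> sector \<Longrightarrow> (F j has_field_derivative F (Suc j) z) (at z)"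
    and bound: "\<And>j. \<exists>C. \<forall>z\<in>sector. norm (F (Suc j) z) \<le> C / (1 + norm z)\<^sup>2"
    and lim: "\<And>t. t \<in> sector \<Longrightarrow> t \<noteq> 0 \<Longrightarrow> (\<lambda>n. F 0 (of_nat n * t)) \<longlonglongrightarrow> 0"
    and N: "N > 0"
  shows "\<exists>C. \<forall>t\<in>sector. 0 < norm t \<longrightarrow> norm t \<le> 1 \<longrightarrow>
           summable (\<lambda>n. F 1 (of_nat n * t)) \<and>
           norm (t * (\<Sum>n. F 1 (of_nat n * t)) + (\<Sum>m<N. bern m * t ^ m * F m 0)) \<le> C * norm t ^ N"
proof -
  obtain C' where "\<forall>z\<in>sector. norm (F (Suc N) z) \<le> C' / (1 + norm z)\<^sup>2"
    using bound by blast
  moreover define C where "C = max C' 0"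
  ultimately have C: "norm (F (Suc N) z) \<le> C / (1 + norm z)\<^sup>2" if "z \<in> sector" for z
    using that by (meson divide_right_mono max.cobounded1 order_trans zero_le_power2)
  have C0: "C \<ge> 0"
    by (simp add: C_def)
  define D where "D = (\<Sum>m<N. norm (bern m))"
  have D0: "D \<ge> 0"
    by (auto simp: D_def intro: sum_nonneg)
  show ?thesis
  proof (intro exI ballI impI)
    fix t assume t: "t \<in> sector" "0 < norm t" "norm t \<le> 1"
    then have nz: "t \<noteq> 0" by auto
    have cn: "of_nat n * t \<in> sector" for n
      using scale_sector [OF t(1), of "real n"] by simp
    obtain C1 where C1: "\<forall>z\<in>sector. norm (F 1 z) \<le> C1 / (1 + norm z)\<^sup>2"
      using bound [of 0] by auto
    have sm: "summable (\<lambda>n. F 1 (of_nat n * t))"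
    proof (rule summable_comparison_test')
      \<comment> \<open>Only summability for fixed \<open>t\<close> is at stake here, so a constant
        depending on \<open>t\<close> is harmless.\<close>
      show "summable (\<lambda>n. C1 / norm t * (norm t / (1 + real n * norm t)\<^sup>2))"
        using t by (intro summable_mult sum_decay_bound)
      show "norm (F 1 (of_nat n * t)) \<le> C1 / norm t * (norm t / (1 + real n * norm t)\<^sup>2)" for n
        using C1 [rule_format, OF cn, of n] t nz by (simp add: norm_mult)
    qed
    \<comment> \<open>Quadratic decay is available from \<open>F 1\<close> on; order 0 rests on the
      hypothesis \<open>lim\<close>.\<close>
    have Flim: "(\<lambda>n. F m (of_nat n * t)) \<longlonglongrightarrow> 0" for m
    proof (cases m)
      case 0
      then show ?thesis using lim t nz by simp
    next
      case (Suc j)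
      obtain B where B: "\<forall>z\<in>sector. norm (F (Suc j) z) \<le> B / (1 + norm z)\<^sup>2"
        using bound by blast
      have "(\<lambda>n. B / (1 + real n * norm t)\<^sup>2) \<longlonglongrightarrow> 0"
        using t by real_asymp
      then show ?thesis
        unfolding Suc
        by (rule Lim_null_comparison [rotated])
           (use B cn in \<open>force simp: norm_mult intro!: always_eventually\<close>)
    qed
    define E where "E z = (\<Sum>m<N. bern m * t ^ m * F m z)" for z
    have "(\<lambda>n. E (of_nat n * t)) \<longlonglongrightarrow> (\<Sum>m<N. bern m * t ^ m * 0)"
      unfolding E_def by (intro tendsto_intros Flim)
    then have "(\<lambda>n. E (of_nat n * t)) \<longlonglongrightarrow> 0"
      by simp
    from telescope_sums [OF this]
    have "(\<lambda>n. E (of_nat (Suc n) * t) - E (of_nat n * t)) sums (- E 0)"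
      by simp
    from sums_diff [OF this sums_mult [OF summable_sums [OF sm], of t]]
    have sums: "(\<lambda>n. E (of_nat (Suc n) * t) - E (of_nat n * t) - t * F 1 (of_nat n * t))
        sums (- E 0 - t * (\<Sum>n. F 1 (of_nat n * t)))" .
    define c where "c n = D * norm t ^ N * C * (norm t / (1 + real n * norm t)\<^sup>2)" for n
    have le: "norm (E (of_nat (Suc n) * t) - E (of_nat n * t) - t * F 1 (of_nat n * t)) \<le> c n" for n
      using Euler_Maclaurin_step [OF deriv C C0 t(1) N, where n = n]
      by (simp add: E_def D_def c_def mult_ac)
    have smc: "summable c"
      unfolding c_def by (intro summable_mult sum_decay_bound t)
    have "norm (- E 0 - t * (\<Sum>n. F 1 (of_nat n * t))) \<le> suminf c"
      using norm_suminf_le [OF le smc] sums by (simp add: sums_iff)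
    also have "suminf c = D * norm t ^ N * C * (\<Sum>n. norm t / (1 + real n * norm t)\<^sup>2)"
      unfolding c_def by (intro suminf_mult sum_decay_bound t)
    also have "\<dots> \<le> D * norm t ^ N * C * 2"
      using C0 D0 by (intro mult_left_mono sum_decay_bound t) auto
    finally have "norm (- (E 0 + t * (\<Sum>n. F 1 (of_nat n * t)))) \<le> 2 * D * C * norm t ^ N"
      by (simp add: algebra_simps)
    then show "summable (\<lambda>n. F 1 (of_nat n * t)) \<and>
           norm (t * (\<Sum>n. F 1 (of_nat n * t)) + (\<Sum>m<N. bern m * t ^ m * F m 0)) \<le> 2 * D * C * norm t ^ N"
      using sm by (simp only: norm_minus_cancel E_def add.commute)
  qed
qed

section \<open>The derivatives of \<open>1 / (e\<^sup>z - 1) - 1 / z\<close>\<close>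

definition expm1_quot :: "complex \<Rightarrow> complex" where
  "expm1_quot z = (if z = 0 then 1 else (exp z - 1) / z)"

definition expm1_quot2 :: "complex \<Rightarrow> complex" where
  "expm1_quot2 z = (if z = 0 then deriv expm1_quot 0 else (expm1_quot z - 1) / z)"

text \<open>Away from \<open>0\<close> this is \<open>1 / (e\<^sup>z - 1) - 1 / z\<close>; the quotient removes the singularity.\<close>

definition bose :: "complex \<Rightarrow> complex" where
  "bose z = - expm1_quot2 z / expm1_quot z"

text \<open>The half-plane carries the nodes \<open>n * t\<close> with \<open>n > 0\<close>; the
  unit disc adds the node 0 and is symmetric under negation. The union avoids the nonzero multiples
  of 2 pi i, where e^z - 1 vanishes.\<close>

definition bose_dom :: "complex set" where
  "bose_dom = {z. 0 < Re z} \<union> ball 0 1"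

text \<open>The function is a difference quotient at 0 completed by the derivative there, so its
  singularity is removable; the same argument serves \<open>expm1_quot2\<close>.\<close>

lemma expm1_quot_holomorphic: "expm1_quot holomorphic_on UNIV"
proof -
  have "deriv exp (0::complex) = 1"
    using DERIV_imp_deriv [OF DERIV_exp [of "0::complex"]] by simp
  then have "expm1_quot = (\<lambda>z. if z = 0 then deriv exp 0 else (exp z - exp 0) / (z - 0))"
    by (auto simp: expm1_quot_def fun_eq_iff)
  then show ?thesis
    using pole_lemma_open [of exp UNIV 0] by (simp add: holomorphic_on_exp)
qed

lemma expm1_quot2_holomorphic: "expm1_quot2 holomorphic_on UNIV"
proof -
  have "expm1_quot2 = (\<lambda>z. if z = 0 then deriv expm1_quot 0
           else (expm1_quot z - expm1_quot 0) / (z - 0))"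
    by (auto simp: expm1_quot2_def expm1_quot_def fun_eq_iff)
  then show ?thesis
    using pole_lemma_open [OF expm1_quot_holomorphic open_UNIV, of 0] by simp
qed

lemma open_bose_dom: "open bose_dom"
  unfolding bose_dom_def by (intro open_Un open_halfspace_Re_gt open_ball)

lemma exp_neq_1_bose_dom:
  assumes "z \<in> bose_dom" "z \<noteq> 0"
  shows "exp z \<noteq> 1"
proof
  assume "exp z = 1"
  then obtain n :: int where n: "Re z = 0" "Im z = of_int (2 * n) * pi"
    using exp_eq_1 by blast
  then have "norm z < 1"
    using assms by (auto simp: bose_dom_def)
  then have "\<bar>Im z\<bar> < 1"
    using abs_Im_le_cmod [of z] by linarith
  moreover have "n \<noteq> 0"
    using n assms by (auto simp: complex_eq_iff)
  then have "\<bar>of_int n\<bar> \<ge> (1::real)"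
    by linarith
  then have "1 * 2 \<le> \<bar>of_int n\<bar> * (2 * pi)"
    using pi_ge_two by (intro mult_mono) auto
  ultimately show False
    using n by (auto simp: abs_mult)
qed

lemma expm1_quot_nonzero: "z \<in> bose_dom \<Longrightarrow> expm1_quot z \<noteq> 0"
  using exp_neq_1_bose_dom by (auto simp: expm1_quot_def)

lemma bose_holomorphic: "bose holomorphic_on bose_dom"
  unfolding bose_def
  by (intro holomorphic_intros holomorphic_on_subset [OF expm1_quot_holomorphic]
        holomorphic_on_subset [OF expm1_quot2_holomorphic] expm1_quot_nonzero) auto

lemma bose_eq:
  assumes "z \<in> bose_dom" "z \<noteq> 0"
  shows "bose z = 1 / (exp z - 1) - 1 / z"
  using exp_neq_1_bose_dom [OF assms] assms(2)
  by (simp add: bose_def expm1_quot_def expm1_quot2_def field_simps)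

text \<open>Oddness of \<open>bose + 1/2\<close>. Off 0 it comes from 1 / (e^(-z) - 1) = -1 - 1 /
  (e^z - 1); at 0 it follows by continuity.\<close>

lemma bose_reflect:
  assumes "norm z < 1"
  shows "bose (- z) = - 1 - bose z"
proof -
  have *: "bose (- z) = - 1 - bose z" if "norm z < 1" "z \<noteq> 0" for z
  proof -
    have d: "z \<in> bose_dom" "- z \<in> bose_dom"
      using that by (auto simp: bose_dom_def)
    show ?thesis
      using exp_neq_1_bose_dom [OF d(1)] that
      by (simp add: bose_eq d exp_minus divide_simps) (simp add: algebra_simps)
  qed
  show ?thesis
  proof (cases "z = 0")
    case True
    have cont: "isCont bose 0"
      using bose_holomorphic open_bose_dom
      by (metis bose_dom_def UnCI centre_in_ball zero_less_one holomorphic_on_imp_continuous_on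
          continuous_on_eq_continuous_at)
    have "((\<lambda>z. bose (- z) + bose z) \<longlongrightarrow> bose (- 0) + bose 0) (at 0)"
      by (intro tendsto_add isContD [OF cont] isCont_tendsto_compose [of _ bose])
         (use cont in \<open>auto intro!: tendsto_eq_intros\<close>)
    moreover have "((\<lambda>z. bose (- z) + bose z) \<longlongrightarrow> - 1) (at 0)"
    proof (rule Lim_transform_within_open [of "\<lambda>_. -1" _ _ _ "ball 0 1"])
      show "- 1 = bose (- x) + bose x" if "x \<in> ball 0 1" "x \<noteq> 0" for x
        using * [of x] that by simp
    qed auto
    ultimately have "bose (- 0) + bose 0 = - 1"
      by (intro LIM_unique)
    then have "bose (- 0) = - 1 - bose 0"
      by (simp only: eq_diff_eq)
    then show ?thesis
      using True by simp
  qed (use * assms in auto)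
qed

lemma bose_0: "bose 0 = - 1 / 2"
  using bose_reflect [of 0] by (simp add: field_simps eq_neg_iff_add_eq_0)

definition dbose :: "nat \<Rightarrow> complex \<Rightarrow> complex" where
  "dbose j = (deriv ^^ j) bose"

lemma dbose_holomorphic: "dbose j holomorphic_on bose_dom"
  unfolding dbose_def by (intro holomorphic_higher_deriv bose_holomorphic open_bose_dom)

lemma dbose_deriv:
  assumes "z \<in> bose_dom"
  shows "(dbose j has_field_derivative dbose (Suc j) z) (at z)"
  using holomorphic_derivI [OF dbose_holomorphic open_bose_dom assms, of j]
  by (simp add: dbose_def)

text \<open>Differentiating \<open>bose_reflect\<close> an even, positive number of times removes
  the constant and shows that the derivative at 0 equals its own negative. This later eliminates odd
  powers of the square root.\<close>

lemma dbose_even_0: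
  assumes "even j" "j > 0"
  shows "dbose j 0 = 0"
proof -
  have hol: "bose holomorphic_on ball 0 1"
    by (rule holomorphic_on_subset [OF bose_holomorphic]) (auto simp: bose_dom_def)
  have "(deriv ^^ j) (\<lambda>w. bose (- 1 * w)) 0 = (- 1) ^ j * (deriv ^^ j) bose (- 1 * 0)"
    by (rule higher_deriv_compose_linear [OF hol open_ball [of 0 1] open_ball]) auto
  moreover have "(deriv ^^ j) (\<lambda>w. bose (- 1 * w)) 0 = (deriv ^^ j) (\<lambda>w. - 1 - bose w) 0"
  proof (rule higher_deriv_transform_within_open [OF _ _ open_ball [of 0 1]])
    show "(\<lambda>w. bose (- 1 * w)) holomorphic_on ball 0 1"
    proof (rule holomorphic_on_compose_gen [OF _ hol, unfolded o_def])
      show "(\<lambda>w. - 1 * w) holomorphic_on ball 0 (1::real)"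
        by (intro holomorphic_intros)
    qed auto
    show "(\<lambda>w. - 1 - bose w) holomorphic_on ball 0 1"
      by (intro holomorphic_intros hol)
  qed (use bose_reflect in auto)
  moreover have "(deriv ^^ j) (\<lambda>w. - 1 - bose w) 0 = - (deriv ^^ j) bose 0"
    using higher_deriv_diff [OF holomorphic_on_const hol open_ball, of 0 j "- 1"] assms by simp
  ultimately show ?thesis
    using assms by (simp add: dbose_def eq_neg_iff_add_eq_0)
qed

text \<open>The derivative is -e^z / (e^z - 1)^2 + 1 / z^2, and each summand is at most 1 / x^2 for
  x = Re z. For the first one, x <= 2 sinh (x / 2) gives x e^(x/2) <= e^x - 1 <= |e^z - 1|.\<close>

lemma dbose_1_bound:
  assumes "0 < Re z"
  shows "norm (dbose 1 z) \<le> 2 / (Re z)\<^sup>2"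
proof -
  define x where "x = Re z"
  have x: "x > 0" using assms by (simp add: x_def)
  have d: "z \<in> bose_dom" and nz: "z \<noteq> 0"
    using assms by (auto simp: bose_dom_def)
  have ne: "exp z \<noteq> 1"
    by (rule exp_neq_1_bose_dom [OF d nz])
  have "((\<lambda>z. 1 / (exp z - 1) - 1 / z) has_field_derivative
           (- exp z / (exp z - 1)\<^sup>2 + 1 / z\<^sup>2)) (at z)"
    using ne nz by (auto intro!: derivative_eq_intros simp: power2_eq_square)
  then have "(bose has_field_derivative (- exp z / (exp z - 1)\<^sup>2 + 1 / z\<^sup>2)) (at z)"
    by (rule has_field_derivative_transform_within_open [OF _ open_halfspace_Re_gt [of 0]])
       (use assms in \<open>auto simp: bose_dom_def intro!: bose_eq [symmetric]\<close>)
  then have eq: "dbose 1 z = - exp z / (exp z - 1)\<^sup>2 + 1 / z\<^sup>2"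
    by (simp add: dbose_def DERIV_imp_deriv)
  have "norm (exp z / (exp z - 1)\<^sup>2) \<le> 1 / x\<^sup>2"
  proof -
    have e: "exp x - 1 \<le> norm (exp z - 1)"
      using norm_triangle_ineq2 [of "exp z" 1] by (simp add: x_def)
    have "x \<le> exp (x / 2) - exp (- x / 2)"
    proof -
      have "x / 2 \<le> (exp (x / 2) - inverse (exp (x / 2))) / 2"
        using x by (intro real_le_x_sinh) auto
      then show ?thesis by (simp add: exp_minus)
    qed
    then have "x * exp (x / 2) \<le> (exp (x / 2) - exp (- x / 2)) * exp (x / 2)"
      by (intro mult_right_mono) auto
    also have "\<dots> = exp x - 1"
      by (simp add: left_diff_distrib flip: exp_add)
    finally have "x * exp (x / 2) \<le> norm (exp z - 1)"
      using e by linarith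
    then have "(x * exp (x / 2))\<^sup>2 \<le> (norm (exp z - 1))\<^sup>2"
      using x by (intro power_mono) auto
    then have "x\<^sup>2 * exp x \<le> (norm (exp z - 1))\<^sup>2"
      by (simp add: power_mult_distrib exp_double [symmetric])
    then show ?thesis
      using x ne by (simp add: norm_divide norm_power x_def field_simps)
  qed
  moreover have "norm (1 / z\<^sup>2) \<le> 1 / x\<^sup>2"
    using x complex_Re_le_cmod [of z]
    by (auto simp: norm_divide norm_power x_def intro!: divide_left_mono power_mono mult_pos_pos)
  ultimately show ?thesis
    unfolding eq using norm_triangle_ineq [of "- exp z / (exp z - 1)\<^sup>2" "1 / z\<^sup>2"]
    by (simp add: x_def norm_divide)
qed

lemma sector_subset_bose_dom: "sector \<subseteq> bose_dom"
  using Re_pos_sector by (fastforce simp: bose_dom_def)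

text \<open>Near 0 compactness suffices. Farther out, Cauchy's inequality on discs of radius 1/6
  carries the quadratic decay of \<open>dbose 1\<close> over to all higher derivatives.\<close>

lemma dbose_decay: "\<exists>C. \<forall>z\<in>sector. norm (dbose (Suc j) z) \<le> C / (1 + norm z)\<^sup>2"
proof -
  have "closed sector"
    unfolding sector_def by (intro closed_Collect_le continuous_intros)
  then have "compact (sector \<inter> cball 0 1)"
    by (simp add: closed_Int_compact)
  moreover have "continuous_on (sector \<inter> cball 0 1) (dbose (Suc j))"
    by (intro holomorphic_on_imp_continuous_on holomorphic_on_subset [OF dbose_holomorphic])
       (use sector_subset_bose_dom in auto)
  ultimately have "bounded (dbose (Suc j) ` (sector \<inter> cball 0 1))"
    by (intro compact_imp_bounded compact_continuous_image)
  then obtain B where B: "B > 0" "\<And>z. z \<in> sector \<Longrightarrow> norm z \<le> 1 \<Longrightarrow> norm (dbose (Suc j) z) \<le> B"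
    by (fastforce simp: bounded_pos)
  \<comment> \<open>The factor 8 comes from 2 / (x/2)^2, \<open>6 ^ j\<close> from the radius 1/6,
    and 36 from 1 + |z| <= 2 |z| <= 6 x, where x = Re z and |z| > 1.\<close>
  define C where "C = fact j * 8 * 6 ^ j * (36::real)"
  have C: "C > 0"
    by (simp add: C_def)
  have "norm (dbose (Suc j) z) \<le> (4 * B + C) / (1 + norm z)\<^sup>2" if z: "z \<in> sector" for z
  proof (cases "norm z \<le> 1")
    case True
    have "norm (dbose (Suc j) z) * (1 + norm z)\<^sup>2 \<le> B * 2\<^sup>2"
      using B z True by (intro mult_mono power_mono) auto
    moreover have "0 < (1 + norm z)\<^sup>2"
      by (intro zero_less_power) (simp add: add_pos_nonneg)
    ultimately show ?thesis
      using C by (simp add: pos_le_divide_eq)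
  next
    case False
    define x where "x = Re z"
    have x: "norm z \<le> 3 * x" "x > 1 / 3"
      using norm_le_sector [OF z] False by (auto simp: x_def)
    \<comment> \<open>Since x > 1/3, the radius 1/6 is less than x/2.\<close>
    have re: "x / 2 \<le> Re w" if "w \<in> cball z (1 / 6)" for w
      using that abs_Re_le_cmod [of "z - w"] x by (auto simp: dist_norm x_def)
    have sub: "cball z (1 / 6) \<subseteq> bose_dom"
      using re x by (force simp: bose_dom_def)
    have "norm ((deriv ^^ j) (dbose 1) z) \<le> fact j * (8 / x\<^sup>2) / (1 / 6) ^ j"
    proof (rule Cauchy_inequality)
      show "dbose 1 holomorphic_on ball z (1 / 6)"
        using sub ball_subset_cball by (blast intro: holomorphic_on_subset [OF dbose_holomorphic])
      show "continuous_on (cball z (1 / 6)) (dbose 1)"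
        using sub
        by (blast intro: holomorphic_on_imp_continuous_on holomorphic_on_subset [OF dbose_holomorphic])
      fix w assume "norm (z - w) = 1 / 6"
      then have w: "x / 2 \<le> Re w"
        by (intro re) (simp add: dist_norm)
      then have "norm (dbose 1 w) \<le> 2 / (Re w)\<^sup>2"
        using x by (intro dbose_1_bound) auto
      also have "\<dots> \<le> 2 / (x / 2)\<^sup>2"
        using x w by (intro divide_left_mono power_mono mult_pos_pos zero_less_power) auto
      finally show "norm (dbose 1 w) \<le> 8 / x\<^sup>2"
        by (simp add: power_divide)
    qed auto
    also have "(deriv ^^ j) (dbose 1) = dbose (Suc j)"
      by (simp add: dbose_def funpow_swap1)
    also have "fact j * (8 / x\<^sup>2) / (1 / 6) ^ j = C / (6 * x)\<^sup>2"
      by (simp add: C_def power_divide power_mult_distrib)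
    also have "\<dots> \<le> C / (1 + norm z)\<^sup>2"
      using C x False
      by (intro divide_left_mono power_mono mult_pos_pos zero_less_power) auto
    also have "\<dots> \<le> (4 * B + C) / (1 + norm z)\<^sup>2"
      using B by (intro divide_right_mono) auto
    finally show ?thesis .
  qed
  then show ?thesis by blast
qed

text \<open>\<open>bose\<close> decays only like 1 / |z| and is thus outside
  \<open>dbose_decay\<close>. This limit provides order 0 of the summation formula in the case
  \<open>k = 1\<close>.\<close>

lemma bose_tendsto_0:
  assumes t: "t \<in> sector" "t \<noteq> 0"
  shows "(\<lambda>n. bose (of_nat n * t)) \<longlonglongrightarrow> 0"
proof -
  define x where "x = Re t"
  have x: "x > 0"
    using Re_pos_sector [OF t] by (simp add: x_def)
  have "norm (bose (of_nat n * t)) \<le> 1 / (exp (real n * x) - 1) + 1 / (real n * x)" if "n > 0" for n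
  proof -
    define z where "z = of_nat n * t"
    have z: "Re z = real n * x" "Re z > 0"
      using that x by (auto simp: z_def x_def)
    then have "bose z = 1 / (exp z - 1) - 1 / z"
      by (intro bose_eq) (auto simp: bose_dom_def)
    then have "norm (bose z) \<le> norm (1 / (exp z - 1)) + norm (1 / z)"
      by (simp add: norm_triangle_ineq4)
    also have "norm (1 / (exp z - 1)) \<le> 1 / (exp (Re z) - 1)"
    proof -
      have "exp (Re z) - 1 \<le> norm (exp z - 1)"
        using norm_triangle_ineq2 [of "exp z" 1] by simp
      moreover have "exp (Re z) - 1 > 0"
        using z by simp
      ultimately show ?thesis
        unfolding norm_divide norm_one by (intro divide_left_mono mult_pos_pos) linarith+
    qed
    also have "norm (1 / z) \<le> 1 / Re z"
      unfolding norm_divide norm_one using z complex_Re_le_cmod [of z]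
      by (intro divide_left_mono mult_pos_pos) linarith+
    finally show ?thesis
      unfolding z_def [symmetric] z(1) [symmetric] by simp
  qed
  moreover have "(\<lambda>n. 1 / (exp (real n * x) - 1) + 1 / (real n * x)) \<longlonglongrightarrow> 0"
    using x by real_asymp
  ultimately show ?thesis
    by (intro Lim_null_comparison [of "\<lambda>n. bose (of_nat n * t)" "\<lambda>n. 1 / (exp (real n * x) - 1) + 1 / (real n * x)"])
       (auto intro: eventually_sequentiallyI [of 1])
qed

section \<open>Lambert series\<close>

text \<open>Termwise differentiation followed by multiplication by \<open>q\<close> raises the
  exponent \<open>k\<close> by one.\<close>

lemma summable_power_mult_geometric:
  fixes q :: "'a::{real_normed_field,banach}"
  assumes "norm q < 1"
  shows "summable (\<lambda>n. of_nat n ^ k * q ^ n)"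
  using assms
proof (induction k arbitrary: q)
  case 0
  then show ?case by (simp add: summable_geometric)
next
  case (Suc k)
  have "summable (\<lambda>n. diffs (\<lambda>n. of_nat n ^ k) n * q ^ n)"
    by (rule termdiff_converges [OF Suc.prems]) (rule Suc.IH)
  then have "summable (\<lambda>n. of_nat (Suc n) ^ Suc k * q ^ n * q)"
    by (intro summable_mult2) (simp add: diffs_def)
  then show ?case
    by (subst summable_Suc_iff [symmetric]) (simp add: mult_ac)
qed

text \<open>Because \<open>0 ^ 0 = 1\<close>, the summand \<open>n = 0\<close> contributes exactly when \<open>k = 0\<close>.\<close>

definition polylog_exp :: "nat \<Rightarrow> complex \<Rightarrow> complex" where
  "polylog_exp k x = (\<Sum>n. of_nat n ^ k * exp (- x) ^ n)"

lemma norm_exp_minus_less_1: "0 < Re x \<Longrightarrow> norm (exp (- x)) < 1"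
  by simp

lemma polylog_exp_deriv:
  assumes "0 < Re x"
  shows "(polylog_exp k has_field_derivative - polylog_exp (Suc k) x) (at x)"
proof -
  define q where "q = exp (- x)"
  have q: "norm q < 1"
    using assms by (simp add: q_def)
  obtain r where r: "norm q < r" "r < 1"
    using q dense by blast
  have K: "norm (of_real r :: complex) < 1" "norm q < norm (of_real r :: complex)"
    using r norm_ge_zero [of q] by (simp_all del: norm_ge_zero)
  define c where "c n = (of_nat n ^ k :: complex)" for n
  have "((\<lambda>q. \<Sum>n. c n * q ^ n) has_field_derivative (\<Sum>n. diffs c n * q ^ n)) (at q)"
    using K unfolding c_def
    by (intro termdiffs_strong [of _ "of_real r"] summable_power_mult_geometric)
  moreover have "((\<lambda>x. exp (- x)) has_field_derivative - q) (at x)"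
    unfolding q_def by (auto intro!: derivative_eq_intros)
  ultimately have "((\<lambda>x. \<Sum>n. c n * exp (- x) ^ n) has_field_derivative
      (\<Sum>n. diffs c n * q ^ n) * - q) (at x)"
    unfolding q_def by (rule DERIV_chain2)
  moreover have "(\<Sum>n. diffs c n * q ^ n) * q = polylog_exp (Suc k) x"
  proof -
    have sm: "summable (\<lambda>n. of_nat n ^ Suc k * q ^ n)"
      by (rule summable_power_mult_geometric [OF q])
    have sm': "summable (\<lambda>n. diffs c n * q ^ n)"
      by (rule termdiff_converges [OF q]) (simp add: c_def summable_power_mult_geometric)
    have "(\<Sum>n. diffs c n * q ^ n) * q = (\<Sum>n. of_nat (Suc n) ^ Suc k * q ^ Suc n)"
      using suminf_mult2 [OF sm', of q] by (simp add: diffs_def c_def mult_ac)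
    \<comment> \<open>The restored term \<open>n = 0\<close> is zero because the exponent
      \<open>Suc k\<close> is positive.\<close>
    also have "\<dots> = (\<Sum>n. of_nat n ^ Suc k * q ^ n)"
      using suminf_split_head [OF sm] by simp
    finally show ?thesis
      by (simp add: polylog_exp_def q_def)
  qed
  ultimately show ?thesis
    by (simp add: polylog_exp_def [abs_def] c_def)
qed

lemma polylog_exp_0:
  assumes "0 < Re x"
  shows "polylog_exp 0 x = 1 + 1 / (exp x - 1)"
proof -
  have ne: "exp x \<noteq> 1"
    using assms by (intro exp_neq_1_bose_dom) (auto simp: bose_dom_def)
  have "polylog_exp 0 x = 1 / (1 - exp (- x))"
    using assms suminf_geometric [of "exp (- x)"] by (simp add: polylog_exp_def)
  also have "\<dots> = 1 + 1 / (exp x - 1)"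
    using ne by (simp add: exp_minus divide_simps)
  finally show ?thesis .
qed

text \<open>Induction by differentiation, since -d/dx raises the index of
  \<open>polylog_exp\<close>. The base case is 1 + 1 / (e^x - 1); its constant 1 disappears with the
  first derivative.\<close>

lemma polylog_exp_eq:
  assumes "0 < Re x"
  shows "polylog_exp k x = of_bool (k = 0) + fact k / x ^ Suc k + (- 1) ^ k * dbose k x"
  using assms
proof (induction k arbitrary: x)
  case 0
  then have "x \<noteq> 0" "x \<in> bose_dom"
    by (auto simp: bose_dom_def)
  with 0 show ?case
    by (simp add: polylog_exp_0 dbose_def bose_eq)
next
  case (Suc k)
  have x: "x \<noteq> 0" "x \<in> bose_dom"
    using Suc.prems by (auto simp: bose_dom_def)
  have "((\<lambda>x. fact k * inverse (x ^ Suc k)) has_field_derivative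
      fact k * - (inverse (x ^ Suc k) * (of_nat (Suc k) * (1 * x ^ (Suc k - Suc 0))) * inverse (x ^ Suc k)))
      (at x)"
    using x by (intro DERIV_cmult DERIV_inverse' DERIV_power DERIV_ident) auto
  also have "fact k * - (inverse (x ^ Suc k) * (of_nat (Suc k) * (1 * x ^ (Suc k - Suc 0))) * inverse (x ^ Suc k))
      = - (fact k * of_nat (Suc k) / x ^ Suc (Suc k))"
    using x by (simp add: field_simps)
  finally have "((\<lambda>x. fact k / x ^ Suc k) has_field_derivative
      - (fact k * of_nat (Suc k) / x ^ Suc (Suc k))) (at x)"
    by (simp only: divide_inverse)
  then have "((\<lambda>x. of_bool (k = 0) + fact k / x ^ Suc k + (- 1) ^ k * dbose k x) has_field_derivative
           - (fact k * of_nat (Suc k) / x ^ Suc (Suc k)) + (- 1) ^ k * dbose (Suc k) x) (at x)"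
    by (rule DERIV_add [OF DERIV_add [OF DERIV_const] DERIV_cmult [OF dbose_deriv [OF x(2)]],
          unfolded add_0_left])
  then have "(polylog_exp k has_field_derivative
           - (fact k * of_nat (Suc k) / x ^ Suc (Suc k)) + (- 1) ^ k * dbose (Suc k) x) (at x)"
    by (rule has_field_derivative_transform_within_open [OF _ open_halfspace_Re_gt [of 0]])
       (use Suc in auto)
  with polylog_exp_deriv [OF Suc.prems, of k]
  have "- polylog_exp (Suc k) x
      = - (fact k * of_nat (Suc k) / x ^ Suc (Suc k)) + (- 1) ^ k * dbose (Suc k) x"
    by (rule DERIV_unique)
  then have "polylog_exp (Suc k) x
      = fact k * of_nat (Suc k) / x ^ Suc (Suc k) - (- 1) ^ k * dbose (Suc k) x"
    by (metis (no_types) add.inverse_inverse minus_add_distrib diff_conv_add_uminus)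
  then show ?case
    by (simp add: mult_ac)
qed

text \<open>Expansion of each quotient into a geometric series and interchange of the two sums. The
  double series converges absolutely: its row sums of norms are at most
  \<open>(m + 1)^k * |q|^(m + 1) / (1 - |q|)\<close>.\<close>

lemma Lambert_series_swap:
  fixes q :: complex
  assumes q: "norm q < 1"
  shows "(\<lambda>n. \<Sum>m. of_nat (Suc m) ^ k * (q ^ Suc n) ^ Suc m)
           sums (\<Sum>m. of_nat (Suc m) ^ k * (q ^ Suc m / (1 - q ^ Suc m)))"
proof -
  define f where "f m n = of_nat (Suc m) ^ k * (q ^ Suc m) ^ Suc n" for m n
  have q': "norm (q ^ Suc m) < 1" for m
    unfolding norm_power using q power_decreasing [of 1 "Suc m" "norm q"] by (simp del: power_Suc)
  have row: "(f m has_sum of_nat (Suc m) ^ k * (q ^ Suc m / (1 - q ^ Suc m))) UNIV"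
      "((\<lambda>n. norm (f m n)) has_sum of_nat (Suc m) ^ k * (norm q ^ Suc m / (1 - norm q ^ Suc m))) UNIV" for m
  proof -
    have geo: "(\<lambda>n. x ^ Suc n) sums (x / (1 - x))" if "norm x < 1" for x :: "'b::real_normed_field"
      using sums_mult [OF geometric_sums [OF that], of x] by simp
    have *: "(\<lambda>n. norm (f m n)) sums (of_nat (Suc m) ^ k * (norm q ^ Suc m / (1 - norm q ^ Suc m)))"
      using sums_mult [OF geo [of "norm q ^ Suc m"], of "of_nat (Suc m) ^ k"] q'[of m]
      by (simp add: f_def norm_mult norm_power del: power_Suc of_nat_Suc)
    then show "((\<lambda>n. norm (f m n)) has_sum of_nat (Suc m) ^ k * (norm q ^ Suc m / (1 - norm q ^ Suc m))) UNIV"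
      using sums_summable [OF *] by (intro norm_summable_imp_has_sum) simp_all
    show "(f m has_sum of_nat (Suc m) ^ k * (q ^ Suc m / (1 - q ^ Suc m))) UNIV"
    proof (rule norm_summable_imp_has_sum)
      show "f m sums (of_nat (Suc m) ^ k * (q ^ Suc m / (1 - q ^ Suc m)))"
        unfolding f_def by (intro sums_mult geo q')
    qed (rule sums_summable [OF *])
  qed
  define A where "A m = real (Suc m) ^ k * (norm q ^ Suc m / (1 - norm q ^ Suc m))" for m
  have smA: "summable A"
  proof (rule summable_comparison_test')
    have "summable (\<lambda>n. of_nat n ^ k * norm q ^ n)"
      by (intro summable_power_mult_geometric) (use q in auto)
    then show "summable (\<lambda>m. of_nat (Suc m) ^ k * norm q ^ Suc m * (1 / (1 - norm q)))"
      by (intro summable_mult2) (subst summable_Suc_iff)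
    show "norm (A m) \<le> of_nat (Suc m) ^ k * norm q ^ Suc m * (1 / (1 - norm q))" for m
    proof -
      have le: "norm q ^ Suc m \<le> norm q ^ 1"
        using q by (intro power_decreasing) auto
      have "norm (A m) = real (Suc m) ^ k * (norm q ^ Suc m / (1 - norm q ^ Suc m))"
        unfolding A_def real_norm_def using le q by (intro abs_of_nonneg) simp
      also have "\<dots> \<le> real (Suc m) ^ k * (norm q ^ Suc m / (1 - norm q))"
        using le q by (intro mult_left_mono divide_left_mono) (auto intro!: mult_pos_pos)
      finally show ?thesis by simp
    qed
  qed
  have A0: "A m \<ge> 0" for m
    using row(2) [of m] unfolding A_def by (rule has_sum_nonneg) simp
  have "(\<lambda>(m, n). norm (f m n)) summable_on UNIV \<times> UNIV"
  proof (rule summable_on_SigmaI [where g = A])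
    show "((\<lambda>n. case (m, n) of (m, n) \<Rightarrow> norm (f m n)) has_sum A m) UNIV" for m
      using row(2) [of m] by (simp only: A_def prod.case)
    show "A summable_on UNIV"
      using smA by (subst summable_on_UNIV_nonneg_real_iff) (rule A0)
  qed simp
  then have sm: "(\<lambda>(m, n). f m n) summable_on UNIV \<times> UNIV"
    unfolding case_prod_unfold by (rule abs_summable_summable)
  then obtain T where T: "((\<lambda>(m, n). f m n) has_sum T) (UNIV \<times> UNIV)"
    by (auto simp: summable_on_def)
  have "((\<lambda>m. of_nat (Suc m) ^ k * (q ^ Suc m / (1 - q ^ Suc m))) has_sum T) UNIV"
    by (rule has_sum_SigmaD [OF T]) (use row(1) in simp)
  then have T_eq: "T = (\<Sum>m. of_nat (Suc m) ^ k * (q ^ Suc m / (1 - q ^ Suc m)))"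
    by (rule sums_unique [OF has_sum_imp_sums])
  have T': "((\<lambda>(n, m). f m n) has_sum T) (UNIV \<times> UNIV)"
    using T has_sum_swap [of "\<lambda>(m, n). f m n"] by (simp only: case_prod_unfold fst_conv snd_conv)
  have col: "((\<lambda>m. f m n) has_sum (\<Sum>m. of_nat (Suc m) ^ k * (q ^ Suc n) ^ Suc m)) UNIV" for n
  proof (rule norm_summable_imp_has_sum)
    have eq: "f m n = of_nat (Suc m) ^ k * (q ^ Suc n) ^ Suc m" for m
      unfolding f_def by (simp only: power_mult [symmetric] mult.commute)
    have "summable (\<lambda>m. of_nat m ^ k * norm (q ^ Suc n) ^ m)"
      using q' by (intro summable_power_mult_geometric) auto
    then have *: "summable (\<lambda>m. of_nat (Suc m) ^ k * norm (q ^ Suc n) ^ Suc m)"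
      by (subst summable_Suc_iff)
    then show "summable (\<lambda>m. norm (f m n))"
      unfolding eq by (simp only: norm_mult norm_power norm_of_nat)
    then have "summable (\<lambda>m. f m n)"
      by (rule summable_norm_cancel)
    then show "(\<lambda>m. f m n) sums (\<Sum>m. of_nat (Suc m) ^ k * (q ^ Suc n) ^ Suc m)"
      unfolding eq by (rule summable_sums)
  qed
  have "((\<lambda>n. \<Sum>m. of_nat (Suc m) ^ k * (q ^ Suc n) ^ Suc m) has_sum T) UNIV"
    by (rule has_sum_SigmaD [OF T']) (use col in simp)
  then show ?thesis
    unfolding T_eq by (rule has_sum_imp_sums)
qed

text \<open>For \<open>q = exp (- t)\<close> the swapped inner sums are \<open>polylog_exp k\<close>
  at the multiples of \<open>t\<close>; their polar parts add up to the zeta value. The Lambert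
  series starts at \<open>n = 1\<close>, the summation formula at \<open>n = 0\<close>, hence the
  subtracted \<open>dbose k 0\<close>.\<close>

lemma Lambert_series_eq:
  assumes k: "k > 0" and t: "0 < Re t"
    and sm: "summable (\<lambda>n. dbose k (of_nat n * t))"
  shows "(\<Sum>m. of_nat (Suc m) ^ k * (exp (- t) ^ Suc m / (1 - exp (- t) ^ Suc m)))
    = fact k * zeta (of_nat (k + 1)) / t ^ (k + 1)
      + (- 1) ^ k * ((\<Sum>n. dbose k (of_nat n * t)) - dbose k 0)"
proof -
  have nz: "t \<noteq> 0" using t by auto
  define L where "L = (\<Sum>m. of_nat (Suc m) ^ k * (exp (- t) ^ Suc m / (1 - exp (- t) ^ Suc m)))"
  have "(\<Sum>m. of_nat (Suc m) ^ k * (exp (- t) ^ Suc n) ^ Suc m)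
      = fact k / t ^ (k + 1) * (1 / of_nat (Suc n) powr of_nat (k + 1))
        + (- 1) ^ k * dbose k (of_nat (Suc n) * t)" (is "?l n = ?r n") for n
  proof -
    have re: "0 < Re (of_nat (Suc n) * t)"
      using t by simp
    have "summable (\<lambda>m. of_nat m ^ k * exp (- (of_nat (Suc n) * t)) ^ m)"
      by (intro summable_power_mult_geometric norm_exp_minus_less_1 re)
    from suminf_split_head [OF this]
    have "(\<Sum>m. of_nat (Suc m) ^ k * exp (- (of_nat (Suc n) * t)) ^ Suc m)
        = polylog_exp k (of_nat (Suc n) * t)"
      using k by (simp add: polylog_exp_def)
    also have "exp (- (of_nat (Suc n) * t)) = exp (- t) ^ Suc n"
      by (subst exp_of_nat_mult [symmetric]) simp
    also have "polylog_exp k (of_nat (Suc n) * t)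
        = fact k / (of_nat (Suc n) * t) ^ Suc k + (- 1) ^ k * dbose k (of_nat (Suc n) * t)"
      using polylog_exp_eq [OF re, of k] k by simp
    also have "fact k / (of_nat (Suc n) * t) ^ Suc k
        = fact k / t ^ (k + 1) * (1 / of_nat (Suc n) powr of_nat (k + 1))"
      by (subst powr_nat') (auto simp: power_mult_distrib simp del: of_nat_Suc)
    finally show ?thesis .
  qed
  with Lambert_series_swap [OF norm_exp_minus_less_1 [OF t], of k] have "?r sums L"
    by (simp only: L_def)
  moreover have "(\<lambda>n. dbose k (of_nat (Suc n) * t)) sums ((\<Sum>n. dbose k (of_nat n * t)) - dbose k 0)"
    using summable_sums [OF sm] by (subst sums_Suc_iff) simp
  then have "(\<lambda>n. (- 1) ^ k * dbose k (of_nat (Suc n) * t)) sums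
      ((- 1) ^ k * ((\<Sum>n. dbose k (of_nat n * t)) - dbose k 0))"
    by (rule sums_mult)
  ultimately have "(\<lambda>n. ?r n - (- 1) ^ k * dbose k (of_nat (Suc n) * t)) sums
      (L - (- 1) ^ k * ((\<Sum>n. dbose k (of_nat n * t)) - dbose k 0))"
    by (rule sums_diff)
  \<comment> \<open>The polar parts are the difference of two convergent series; normalising them
    yields the zeta series together with its convergence.\<close>
  then have "(\<lambda>n. t ^ (k + 1) / fact k *
        (fact k / t ^ (k + 1) * (1 / of_nat (Suc n) powr of_nat (k + 1)))) sums
      (t ^ (k + 1) / fact k * (L - (- 1) ^ k * ((\<Sum>n. dbose k (of_nat n * t)) - dbose k 0)))"
    unfolding add_diff_cancel_right' by (rule sums_mult)
  moreover have "t ^ (k + 1) / fact k * (fact k / t ^ (k + 1) * c) = c" for c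
    using nz by simp
  ultimately have "zeta (of_nat (k + 1)) =
      t ^ (k + 1) / fact k * (L - (- 1) ^ k * ((\<Sum>n. dbose k (of_nat n * t)) - dbose k 0))"
    unfolding zeta_def by (simp only: sums_iff)
  then have "fact k * zeta (of_nat (k + 1)) / t ^ (k + 1) =
      L - (- 1) ^ k * ((\<Sum>n. dbose k (of_nat n * t)) - dbose k 0)"
    using nz by simp
  then show ?thesis
    unfolding L_def [symmetric] by (simp only: diff_add_cancel)
qed

section \<open>Expansion at the branch point\<close>

text \<open>The value at \<open>w\<^sup>2\<close> is \<open>artanh w / w\<close>.\<close>

definition artanh_quot :: "complex \<Rightarrow> complex" where
  "artanh_quot u = (\<Sum>n. u ^ n / of_nat (2 * n + 1))"

lemma artanh_quot_sums:
  assumes "norm u < 1"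
  shows "(\<lambda>n. u ^ n / of_nat (2 * n + 1)) sums artanh_quot u"
proof -
  have "summable (\<lambda>n. u ^ n / of_nat (2 * n + 1))"
  proof (rule summable_comparison_test')
    show "summable (\<lambda>n. norm u ^ n)"
      using assms by (simp add: summable_geometric)
    show "norm (u ^ n / of_nat (2 * n + 1)) \<le> norm u ^ n" for n
    proof -
      have "norm u ^ n / real (2 * n + 1) \<le> norm u ^ n / 1"
        by (intro divide_left_mono) auto
      then show ?thesis
        by (simp only: norm_divide norm_power norm_of_nat div_by_1)
    qed
  qed
  then show ?thesis
    unfolding artanh_quot_def by (rule summable_sums)
qed

lemma artanh_quot_holomorphic: "artanh_quot holomorphic_on ball 0 1"
proof (rule power_series_holomorphic)
  show "(\<lambda>n. 1 / of_nat (2 * n + 1) * (w - 0) ^ n) sums artanh_quot w" if "w \<in> ball 0 1" for w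
    using artanh_quot_sums [of w] that by simp
qed

lemma artanh_quot_0: "artanh_quot 0 = 1"
proof -
  have "artanh_quot 0 = (\<Sum>n. (1 / of_nat (2 * n + 1)) * 0 ^ n)"
    by (simp add: artanh_quot_def)
  also have "\<dots> = 1"
    by (subst powser_zero) simp
  finally show ?thesis .
qed

text \<open>The arctangent series at \<open>\<i> * w\<close> sums to
  \<open>\<i> * w * artanh_quot (w^2)\<close>, and the logarithmic form of \<open>Arctan\<close>
  turns this into \<open>Ln ((1 + w) / (1 - w))\<close>.\<close>

lemma exp_artanh_quot:
  assumes w: "norm w < 1"
  shows "exp (- (2 * w * artanh_quot (w\<^sup>2))) = (1 - w) / (1 + w)"
proof -
  have "norm (w\<^sup>2) < 1"
    using w by (simp add: norm_power abs_square_less_1)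
  from sums_mult [OF artanh_quot_sums [OF this], of "\<i> * w"]
  have "(\<lambda>n. \<i> * w * ((w\<^sup>2) ^ n / of_nat (2 * n + 1))) sums (\<i> * w * artanh_quot (w\<^sup>2))" .
  moreover have "\<i> * w * ((w\<^sup>2) ^ n / of_nat (2 * n + 1))
      = (- 1) ^ n / of_nat (2 * n + 1) * (\<i> * w) ^ (2 * n + 1)" for n
  proof -
    have "(\<i> * w) ^ (2 * n + 1) = \<i> * w * ((- 1) ^ n * (w\<^sup>2) ^ n)"
      by (simp add: power_mult power_mult_distrib power_minus [of "w\<^sup>2"])
    then have "(- 1) ^ n * (\<i> * w) ^ (2 * n + 1) = \<i> * w * (((- 1) ^ n * (- 1) ^ n) * (w\<^sup>2) ^ n)"
      by (simp only: mult_ac)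
    also have "(- 1) ^ n * (- 1) ^ n = (1::complex)"
      by (simp flip: power_mult_distrib)
    finally show ?thesis
      by (simp only: times_divide_eq_left times_divide_eq_right mult_1_left)
  qed
  ultimately have "(\<lambda>n. (- 1) ^ n / of_nat (2 * n + 1) * (\<i> * w) ^ (2 * n + 1))
      sums (\<i> * w * artanh_quot (w\<^sup>2))"
    by (simp only:)
  moreover have "(\<lambda>n. (- 1) ^ n / of_nat (2 * n + 1) * (\<i> * w) ^ (2 * n + 1)) sums Arctan (\<i> * w)"
    by (rule Arctan_series(2)) (use w in \<open>simp add: norm_mult\<close>)
  ultimately have eq: "\<i> * w * artanh_quot (w\<^sup>2) = Arctan (\<i> * w)"
    by (rule sums_unique2)
  have "- (2 * w * artanh_quot (w\<^sup>2)) = 2 * \<i> * (\<i> * w * artanh_quot (w\<^sup>2))"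
    by (simp add: algebra_simps)
  also have "\<dots> = - Ln ((1 + w) / (1 - w))"
  proof -
    have "\<i> * (\<i> * w) = - w"
      by (simp flip: mult.assoc)
    then show ?thesis
      unfolding eq Arctan_def by simp
  qed
  finally have "exp (- (2 * w * artanh_quot (w\<^sup>2))) = inverse (exp (Ln ((1 + w) / (1 - w))))"
    by (simp only: exp_minus)
  moreover have "w \<noteq> - 1" "w \<noteq> 1"
    using w by auto
  then have "1 + w \<noteq> 0" "1 - w \<noteq> 0"
    by (auto simp: eq_neg_iff_add_eq_0 add.commute)
  ultimately show ?thesis
    by simp
qed

text \<open>
  For \<open>z\<close> in the closed unit disc, \<open>1 - z\<close> lies in the right half-plane; the wider wedge leaves room for
  discs around \<open>1 - z\<close> of radius proportional to \<open>|1 - z|\<close>.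
\<close>

definition wedge :: "complex set" where
  "wedge = {u. - norm u / 2 \<le> Re u}"

text \<open>For csqrt u = x + i y one has Re u = x^2 - y^2 and |u| = x^2 + y^2, so the wedge
  condition reads y^2 <= 3 x^2; and sqrt 3 < 7/4.\<close>

lemma csqrt_wedge:
  assumes "u \<in> wedge"
  shows "\<bar>Im (csqrt u)\<bar> \<le> 7 / 4 * Re (csqrt u)"
proof -
  define w where "w = csqrt u"
  define x y where "x = Re w" and "y = Im w"
  have x: "x \<ge> 0"
    using csqrt_principal [of u] by (auto simp: x_def w_def)
  have u: "u = w\<^sup>2"
    by (simp add: w_def)
  have "Re u = x\<^sup>2 - y\<^sup>2"
    by (simp add: u x_def y_def Re_power2)
  moreover have "norm u = x\<^sup>2 + y\<^sup>2"
    by (simp only: u norm_power x_def y_def cmod_power2)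
  ultimately have "y\<^sup>2 \<le> 3 * x\<^sup>2"
    using assms by (simp add: wedge_def field_simps)
  also have "\<dots> \<le> (7 / 4 * x)\<^sup>2"
    by (simp add: power_mult_distrib power_divide)
  finally have "\<bar>y\<bar> \<le> \<bar>7 / 4 * x\<bar>"
    by (simp only: abs_le_square_iff)
  then show ?thesis
    using x by (simp add: x_def y_def w_def)
qed

text \<open>For \<open>norm u < 1\<close> this is the parameter t with
  \<open>exp (- t) = b (1 - u)\<close>, twice the inverse hyperbolic tangent of
  \<open>csqrt u\<close>.\<close>

definition bose_param :: "complex \<Rightarrow> complex" where
  "bose_param u = csqrt u * (2 * artanh_quot u)"

text \<open>All claims follow from continuity of \<open>artanh_quot\<close> at 0, where its value is
  1. The radius 1/9 gives \<open>norm (csqrt u) \<le> 1 / 3\<close>, hence a parameter of norm at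
  most 1, as the summation formula demands.\<close>

lemma bose_param_near_0:
  obtains r where "0 < r" "r \<le> 1 / 9"
    and "\<And>u. norm u < r \<Longrightarrow> artanh_quot u \<noteq> 0"
    and "\<And>u. norm u < r \<Longrightarrow> norm (bose_param u) \<le> 3 * norm (csqrt u)"
    and "\<And>u. norm u < r \<Longrightarrow> norm (csqrt u) \<le> 1 / 3"
    and "\<And>u. norm u < r \<Longrightarrow> u \<in> wedge \<Longrightarrow> bose_param u \<in> sector"
proof -
  have "isCont artanh_quot 0"
    using artanh_quot_holomorphic
    by (meson centre_in_ball continuous_on_eq_continuous_at holomorphic_on_imp_continuous_on
        open_ball zero_less_one)
  then obtain d where d: "d > 0" "\<And>u. norm u < d \<Longrightarrow> norm (artanh_quot u - 1) < 1 / 50"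
    unfolding continuous_at_eps_delta artanh_quot_0
    by (auto simp: dist_norm dest!: spec [of _ "1 / 50 :: real"])
  have "norm (bose_param u) \<le> 3 * norm (csqrt u)" if "norm u < d" for u
  proof -
    have "norm (artanh_quot u) \<le> 3 / 2"
      using d(2) [OF that] norm_triangle_ineq [of "artanh_quot u - 1" 1] by simp
    then have "norm (csqrt u) * (2 * norm (artanh_quot u)) \<le> norm (csqrt u) * (2 * (3 / 2))"
      by (intro mult_left_mono) auto
    then show ?thesis
      by (simp add: bose_param_def norm_mult)
  qed
  moreover have "norm (csqrt u) \<le> 1 / 3" if "norm u < 1 / 9" for u
  proof -
    have "(norm (csqrt u))\<^sup>2 \<le> (1 / 3)\<^sup>2"
      unfolding norm_power [symmetric] power2_csqrt using that by (simp add: power_divide)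
    then show ?thesis
      by (rule power2_le_imp_le) simp
  qed
  moreover have "bose_param u \<in> sector" if u: "norm u < d" "u \<in> wedge" for u
  proof -
    define w e where "w = csqrt u" and "e = artanh_quot u - 1"
    define x where "x = Re w"
    have y: "\<bar>Im w\<bar> \<le> 7 / 4 * x"
      using csqrt_wedge [OF u(2)] by (simp add: x_def w_def)
    then have nw: "norm w \<le> 11 / 4 * x"
      using cmod_le [of w] by (simp add: x_def)
    have x0: "x \<ge> 0"
      using y by linarith
    \<comment> \<open>The tolerance 1/50 is small enough because 7/4 + 11/200 <= 2 * (1 -
      11/200).\<close>
    have "norm (w * e) \<le> 11 / 4 * x * (1 / 50)"
      unfolding norm_mult using nw x0 d(2) [OF u(1)]
      by (intro mult_mono) (auto simp: e_def)
    then have "\<bar>Re (w * e)\<bar> \<le> 11 / 200 * x" "\<bar>Im (w * e)\<bar> \<le> 11 / 200 * x"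
      using abs_Re_le_cmod [of "w * e"] abs_Im_le_cmod [of "w * e"] by linarith+
    moreover have "bose_param u = 2 * w + 2 * (w * e)"
      by (simp add: bose_param_def w_def e_def algebra_simps)
    then have "Re (bose_param u) = 2 * x + 2 * Re (w * e)" "Im (bose_param u) = 2 * Im w + 2 * Im (w * e)"
      by (simp_all add: x_def)
    ultimately have "\<bar>Im (bose_param u)\<bar> \<le> 2 * Re (bose_param u)"
      using y by linarith
    then show ?thesis
      by (simp add: sector_def)
  qed
  moreover have "artanh_quot u \<noteq> 0" if "norm u < d" for u
    using d(2) [OF that] by auto
  ultimately show ?thesis
    using that [of "min d (1 / 9)"] d(1) by simp
qed

section \<open>Local expansions of \<open>g\<close> and \<open>wp\<close> in powers of u = 1 -
  z\<close>

lemma holomorphic_Taylor_bound: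
  assumes f: "f holomorphic_on ball 0 r" and r: "0 < r"
  obtains c C where "C \<ge> 0"
    "\<And>u. norm u < r / 2 \<Longrightarrow> norm (f u - f 0 + (\<Sum>l=1..M. c l * u ^ l)) \<le> C * norm u ^ Suc M"
proof -
  have "continuous_on (cball 0 (r / 2)) ((deriv ^^ Suc M) f)"
    using r
    by (intro holomorphic_on_imp_continuous_on
          holomorphic_on_subset [OF holomorphic_higher_deriv [OF f open_ball]]) auto
  then have "bounded ((deriv ^^ Suc M) f ` cball 0 (r / 2))"
    by (intro compact_imp_bounded compact_continuous_image) auto
  then obtain B where B: "B > 0" "\<And>z. norm z \<le> r / 2 \<Longrightarrow> norm ((deriv ^^ Suc M) f z) \<le> B"
    by (auto simp: bounded_pos)
  \<comment> \<open>The sign is reversed because \<open>wp\<close> adds its correcting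
    polynomials.\<close>
  define c where "c l = - ((deriv ^^ l) f 0 / fact l)" for l
  have "norm (f u - f 0 + (\<Sum>l=1..M. c l * u ^ l)) \<le> B / fact M * norm u ^ Suc M"
    if u: "norm u < r / 2" for u
  proof -
    have "norm ((deriv ^^ 0) f u - (\<Sum>i\<le>M. (deriv ^^ i) f 0 * (u - 0) ^ i / fact i))
        \<le> B * norm (u - 0) ^ Suc M / fact M"
    proof (rule complex_Taylor [of "cball 0 (r / 2)" M "\<lambda>i. (deriv ^^ i) f"])
      show "((deriv ^^ i) f has_field_derivative (deriv ^^ Suc i) f x) (at x within cball 0 (r / 2))"
        if "x \<in> cball 0 (r / 2)" for i x
        using holomorphic_derivI [OF holomorphic_higher_deriv [OF f open_ball] open_ball, of x i] that r
        by (auto intro: has_field_derivative_at_within)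
    qed (use B u r in auto)
    also have "(\<Sum>i\<le>M. (deriv ^^ i) f 0 * (u - 0) ^ i / fact i)
        = f 0 - (\<Sum>l=1..M. c l * u ^ l)"
      by (simp add: atMost_atLeast0 sum.atLeast_Suc_atMost c_def sum_negf)
    finally show ?thesis by (simp add: algebra_simps)
  qed
  then show ?thesis
    using that B by (meson divide_nonneg_pos fact_gt_zero less_imp_le)
qed

text \<open>The term of index \<open>m\<close> in the summation formula carries
  \<open>w^(k + m)\<close> with w = csqrt u. By \<open>dbose_even_0\<close> it vanishes for odd
  \<open>k + m\<close>, except when \<open>k = 1\<close> and \<open>m = 0\<close>. The surviving
  even powers are powers of \<open>u\<close> and form \<open>reg\<close>; the exception is the
  square root term.\<close>

lemma g_near_1:
  assumes k: "k > 0"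
  obtains r C reg where "0 < r" "r \<le> 1 / 9"
    and "reg holomorphic_on ball 0 r"
    and "reg 0 = fact k * zeta (of_nat (k + 1)) / 2 ^ (k + 1)"
    and "\<And>u. u \<in> ball 0 r \<Longrightarrow> artanh_quot u \<noteq> 0"
    and "\<And>u. u \<in> wedge \<Longrightarrow> u \<noteq> 0 \<Longrightarrow> norm u < r \<Longrightarrow>
          norm (g k (1 - u) - reg u + of_bool (k = 1) * csqrt u * (1 / (4 * artanh_quot u)))
            \<le> C * norm u ^ Suc M"
proof -
  obtain r where r: "0 < r" "r \<le> 1 / 9"
    and A0: "\<And>u. norm u < r \<Longrightarrow> artanh_quot u \<noteq> 0"
    and t_le: "\<And>u. norm u < r \<Longrightarrow> norm (bose_param u) \<le> 3 * norm (csqrt u)"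
    and w_le: "\<And>u. norm u < r \<Longrightarrow> norm (csqrt u) \<le> 1 / 3"
    and t_sec: "\<And>u. norm u < r \<Longrightarrow> u \<in> wedge \<Longrightarrow> bose_param u \<in> sector"
    by (rule bose_param_near_0) (rule that)
  \<comment> \<open>The formula sums \<open>F 1\<close>; starting the sequence of derivatives at
    order \<open>k - 1\<close> makes this \<open>dbose k\<close>.\<close>
  obtain \<kappa> where \<kappa>: "k = Suc \<kappa>"
    using k gr0_implies_Suc by blast
  \<comment> \<open>The error t^N is divided by \<open>t\<close> and multiplied by
    \<open>w^(k + 1)\<close>. One factor \<open>w\<close> and t^(2M+1) already give the order
    |w|^(2M+2) = |u|^(M+1).\<close>
  define N where "N = Suc (2 * M + 1)"
  have "\<exists>C. \<forall>t\<in>sector. 0 < norm t \<longrightarrow> norm t \<le> 1 \<longrightarrow>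
      summable (\<lambda>n. dbose (\<kappa> + 1) (of_nat n * t)) \<and>
      norm (t * (\<Sum>n. dbose (\<kappa> + 1) (of_nat n * t)) + (\<Sum>m<N. bern m * t ^ m * dbose (\<kappa> + m) 0))
        \<le> C * norm t ^ N"
  proof (rule Euler_Maclaurin_sector [of "\<lambda>j. dbose (\<kappa> + j)"])
    show "(dbose (\<kappa> + j) has_field_derivative dbose (\<kappa> + Suc j) z) (at z)" if "z \<in> sector" for j z
      using dbose_deriv sector_subset_bose_dom that by auto
    show "\<exists>C. \<forall>z\<in>sector. norm (dbose (\<kappa> + Suc j) z) \<le> C / (1 + norm z)\<^sup>2" for j
      using dbose_decay [of "\<kappa> + j"] by simp
    show "(\<lambda>n. dbose (\<kappa> + 0) (of_nat n * t)) \<longlonglongrightarrow> 0" if t: "t \<in> sector" "t \<noteq> 0" for t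
    proof (cases \<kappa>)
      case 0
      then show ?thesis
        using bose_tendsto_0 [OF t] by (simp add: dbose_def)
    next
      case (Suc j)
      obtain B where B: "\<And>z. z \<in> sector \<Longrightarrow> norm (dbose (Suc j) z) \<le> B / (1 + norm z)\<^sup>2"
        using dbose_decay by blast
      have "(\<lambda>n. B / (1 + real n * norm t)\<^sup>2) \<longlonglongrightarrow> 0"
        using t by real_asymp
      moreover have "norm (dbose \<kappa> (of_nat n * t)) \<le> B / (1 + real n * norm t)\<^sup>2" for n
        using B [of "of_nat n * t"] scale_sector [OF t(1), of "real n"] Suc by (simp add: norm_mult)
      ultimately show ?thesis
        by (intro Lim_null_comparison [of "\<lambda>n. dbose (\<kappa> + 0) (of_nat n * t)" "\<lambda>n. B / (1 + real n * norm t)\<^sup>2"]) auto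
    qed
  qed (simp add: N_def)
  then obtain C where C: "\<forall>t\<in>sector. 0 < norm t \<longrightarrow> norm t \<le> 1 \<longrightarrow>
      summable (\<lambda>n. dbose k (of_nat n * t)) \<and>
      norm (t * (\<Sum>n. dbose k (of_nat n * t)) + (\<Sum>m<N. bern m * t ^ m * dbose (\<kappa> + m) 0))
        \<le> C * norm t ^ N"
    unfolding Suc_eq_plus1 [symmetric] \<kappa> [symmetric] ..
  define a where "a u = 2 * artanh_quot u" for u
  define Z where "Z = fact k * zeta (of_nat (k + 1))"
  \<comment> \<open>Here \<open>a u\<close> is the quotient t / w. The rounded exponents replace
    powers of \<open>w\<close> correctly, since an odd power of \<open>w\<close> has coefficient 0;
    the one exception, \<open>\<kappa> + m = 0\<close>, is left out.\<close>
  define reg where "reg u = Z / a u ^ (k + 1) - (- 1) ^ k * (dbose k 0 * u ^ ((k + 1) div 2)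
      + (\<Sum>m<N. if \<kappa> + m = 0 then 0
           else bern m * dbose (\<kappa> + m) 0 * (u ^ ((k + m) div 2) * a u ^ m / a u)))" for u
  have a0: "a u \<noteq> 0" if "norm u < r" for u
    using A0 [OF that] by (simp add: a_def)
  have hola: "a holomorphic_on ball 0 r"
    unfolding a_def using r
    by (intro holomorphic_intros holomorphic_on_subset [OF artanh_quot_holomorphic]) auto
  have holr: "reg holomorphic_on ball 0 r"
  proof -
    have "(\<lambda>u. if \<kappa> + m = 0 then 0
           else bern m * dbose (\<kappa> + m) 0 * (u ^ ((k + m) div 2) * a u ^ m / a u)) holomorphic_on ball 0 r" for m
      by (cases "\<kappa> + m = 0") (use a0 hola in \<open>auto intro!: holomorphic_intros\<close>)
    then show ?thesis
      unfolding reg_def using a0 by (intro holomorphic_intros hola) auto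
  qed
  have reg0: "reg 0 = Z / 2 ^ (k + 1)"
  proof -
    have "(\<Sum>m<N. if \<kappa> + m = 0 then 0
           else bern m * dbose (\<kappa> + m) 0 * (0 ^ ((k + m) div 2) * a 0 ^ m / a 0)) = 0"
      by (intro sum.neutral) (auto simp: \<kappa> zero_power)
    then show ?thesis
      using k by (simp add: reg_def a_def artanh_quot_0 zero_power)
  qed
  have main: "norm (g k (1 - u) - reg u + of_bool (k = 1) * csqrt u * (1 / (4 * artanh_quot u)))
            \<le> \<bar>C\<bar> * 3 ^ (2 * M + 1) * norm u ^ Suc M"
    if u: "u \<in> wedge" "u \<noteq> 0" "norm u < r" for u
  proof -
    define w t where "w = csqrt u" and "t = bose_param u"
    have t: "t = w * a u"
      by (simp add: t_def w_def bose_param_def a_def)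
    have w0: "w \<noteq> 0" and au: "a u \<noteq> 0" and w2: "w\<^sup>2 = u"
      using u a0 by (auto simp: w_def)
    have t0: "t \<noteq> 0"
      using w0 au by (simp add: t)
    have nw: "norm w \<le> 1 / 3" and nt: "norm t \<le> 3 * norm w" and tK: "t \<in> sector"
      using w_le t_le t_sec u by (auto simp: w_def t_def)
    define S where "S = (\<Sum>n. dbose k (of_nat n * t))"
    define err where "err = t * S + (\<Sum>m<N. bern m * t ^ m * dbose (\<kappa> + m) 0)"
    have sm: "summable (\<lambda>n. dbose k (of_nat n * t))" and err: "norm err \<le> C * norm t ^ N"
      using C [rule_format, OF tK] t0 nt nw by (auto simp: err_def S_def)
    have "b (1 - u) = exp (- t)"
      using exp_artanh_quot [of w] nw by (simp add: b_def w2 t a_def mult_ac flip: w_def)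
    then have "g k (1 - u) = w ^ (k + 1) * (Z / t ^ (k + 1) + (- 1) ^ k * (S - dbose k 0))"
      using Lambert_series_eq [OF k Re_pos_sector [OF tK t0] sm]
      by (simp add: g_def Z_def S_def flip: w_def)
    also have "S = (err - (\<Sum>m<N. bern m * t ^ m * dbose (\<kappa> + m) 0)) / t"
      using t0 by (simp add: err_def)
    also have "w ^ (k + 1) * (Z / t ^ (k + 1) + (- 1) ^ k *
          ((err - (\<Sum>m<N. bern m * t ^ m * dbose (\<kappa> + m) 0)) / t - dbose k 0))
        = Z * (w ^ (k + 1) / t ^ (k + 1)) - (- 1) ^ k * (dbose k 0 * w ^ (k + 1)
            + w ^ (k + 1) / t * (\<Sum>m<N. bern m * t ^ m * dbose (\<kappa> + m) 0))
          + (- 1) ^ k * (w ^ (k + 1) / t * err)"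
      (is "?lhs = ?rhs")
    proof -
      have "W * (Z / T + s * ((e - X) / t - d)) = Z * (W / T) - s * (d * W + W / t * X) + s * (W / t * e)"
        for W T s e X d :: complex
        by (simp add: diff_divide_distrib algebra_simps)
      then show ?thesis .
    qed
    finally have expand: "g k (1 - u) = ?rhs" .
    have e1: "w ^ (k + 1) / t ^ (k + 1) = 1 / a u ^ (k + 1)"
      using w0 by (simp only: t power_mult_distrib) simp
    have e2: "dbose k 0 * w ^ (k + 1) = dbose k 0 * u ^ ((k + 1) div 2)"
    proof (cases "even k")
      case True
      then show ?thesis using dbose_even_0 [of k] k by simp
    next
      case False
      then show ?thesis
        unfolding w2 [symmetric] power_mult [symmetric] by simp
    qed
    have "w ^ (k + 1) / t * (\<Sum>m<N. bern m * t ^ m * dbose (\<kappa> + m) 0)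
        = (\<Sum>m<N. bern m * dbose (\<kappa> + m) 0 * (w ^ (k + m) * a u ^ m / a u))"
      unfolding sum_distrib_left using w0 au
      by (intro sum.cong refl) (simp add: t power_mult_distrib power_add field_simps)
    also have "\<dots> = (\<Sum>m<N. if \<kappa> + m = 0 then 0
           else bern m * dbose (\<kappa> + m) 0 * (u ^ ((k + m) div 2) * a u ^ m / a u))
         + of_bool (k = 1) * (bern 0 * dbose 0 0 * (w / a u))" (is "sum ?l _ = sum ?r _ + ?e")
    proof -
      have "?l m = ?r m + (if m = 0 then ?e else 0)" for m
      proof (cases "\<kappa> + m = 0")
        case True
        then show ?thesis by (simp add: \<kappa>)
      next
        case False
        have "dbose (\<kappa> + m) 0 * w ^ (k + m) = dbose (\<kappa> + m) 0 * u ^ ((k + m) div 2)"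
        proof (cases "even (\<kappa> + m)")
          case True
          then show ?thesis using dbose_even_0 [of "\<kappa> + m"] False by simp
        next
          case odd: False
          then have "even (k + m)" by (simp add: \<kappa>)
          then show ?thesis
            unfolding w2 [symmetric] power_mult [symmetric] by simp
        qed
        then have "bern m * (dbose (\<kappa> + m) 0 * w ^ (k + m)) * (a u ^ m / a u)
            = bern m * (dbose (\<kappa> + m) 0 * u ^ ((k + m) div 2)) * (a u ^ m / a u)"
          by (simp only:)
        then have "?l m = ?r m"
          unfolding if_not_P [OF False] by (simp only: mult.assoc times_divide_eq_right)
        moreover have "(if m = 0 then ?e else 0) = 0"
          using False by (auto simp: \<kappa>)
        ultimately show ?thesis by simp
      qed
      then have "sum ?l {..<N} = sum ?r {..<N} + (\<Sum>m<N. if m = 0 then ?e else 0)"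
        by (simp only: sum.distrib)
      also have "(\<Sum>m<N. if m = 0 then ?e else 0) = ?e"
        by (subst sum.delta) (auto simp: N_def)
      finally show ?thesis .
    qed
    finally have e3: "w ^ (k + 1) / t * (\<Sum>m<N. bern m * t ^ m * dbose (\<kappa> + m) 0) = \<dots>" .
    have "g k (1 - u) = reg u - (- 1) ^ k * (of_bool (k = 1) * (bern 0 * dbose 0 0 * (w / a u)))
        + (- 1) ^ k * (w ^ (k + 1) / t * err)"
      unfolding expand e1 e2 e3 reg_def by (simp add: algebra_simps)
    \<comment> \<open>For \<open>k = 1\<close> the factors -1, \<open>bern 0 = 1\<close>,
      \<open>bose 0 = -1/2\<close> and \<open>a u = 2 * artanh_quot u\<close> combine to this
      term.\<close>
    moreover have "(- 1) ^ k * (of_bool (k = 1) * (bern 0 * dbose 0 0 * (w / a u)))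
        = of_bool (k = 1) * w * (1 / (4 * artanh_quot u))"
      by (simp add: bern_0 dbose_def bose_0 a_def)
    ultimately have "g k (1 - u) - reg u + of_bool (k = 1) * csqrt u * (1 / (4 * artanh_quot u))
        = (- 1) ^ k * (w ^ (k + 1) / t * err)"
      by (simp add: w_def)
    also have "norm \<dots> = norm w ^ (k + 1) / norm t * norm err"
      by (simp add: norm_mult norm_divide norm_power)
    also have "\<dots> \<le> norm w ^ (k + 1) / norm t * (\<bar>C\<bar> * norm t ^ N)"
    proof (intro mult_left_mono)
      have "C * norm t ^ N \<le> \<bar>C\<bar> * norm t ^ N"
        by (intro mult_right_mono) auto
      then show "norm err \<le> \<bar>C\<bar> * norm t ^ N"
        using err by linarith
    qed simp
    also have "\<dots> = \<bar>C\<bar> * (norm w ^ (k + 1) * norm t ^ (2 * M + 1))"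
      using t0 by (simp add: N_def)
    also have "\<dots> \<le> \<bar>C\<bar> * (norm w ^ 1 * (3 * norm w) ^ (2 * M + 1))"
      using nw nt by (intro mult_left_mono mult_mono power_mono power_decreasing) auto
    also have "\<dots> = \<bar>C\<bar> * 3 ^ (2 * M + 1) * (norm w)\<^sup>2 ^ Suc M"
      by (simp add: power_mult_distrib power_add mult_2 power2_eq_square)
    also have "(norm w)\<^sup>2 = norm u"
      by (simp only: norm_power [symmetric] w2)
    finally show ?thesis .
  qed
  show ?thesis
    by (rule that [OF r holr reg0 [unfolded Z_def] _ main]) (use A0 in auto)
qed

text \<open>\<open>lam\<close> cancels the Taylor polynomial of \<open>reg\<close>, and
  \<open>lam'\<close> that of the cofactor \<open>-1 / (4 * artanh_quot u)\<close> of the square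
  root. Their values at 0 are exactly the zeta constant and -1/4, which \<open>wp\<close> already
  compensates.\<close>

lemma wp_near_1:
  assumes k: "k > 0"
  obtains lam lam' C r where "0 < r" "r \<le> 1"
    and "\<And>u. u \<in> wedge \<Longrightarrow> u \<noteq> 0 \<Longrightarrow> norm u < r \<Longrightarrow>
          norm (wp k M lam lam' (1 - u)) \<le> C * norm u ^ Suc M"
proof -
  obtain r C reg where r: "0 < r" "r \<le> 1 / 9"
    and hol: "reg holomorphic_on ball 0 r"
    and reg0: "reg 0 = fact k * zeta (of_nat (k + 1)) / 2 ^ (k + 1)"
    and A0: "\<And>u. u \<in> ball 0 r \<Longrightarrow> artanh_quot u \<noteq> 0"
    and g: "\<And>u. u \<in> wedge \<Longrightarrow> u \<noteq> 0 \<Longrightarrow> norm u < r \<Longrightarrow>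
          norm (g k (1 - u) - reg u + of_bool (k = 1) * csqrt u * (1 / (4 * artanh_quot u)))
            \<le> C * norm u ^ Suc M"
    by (rule g_near_1 [OF k, of M]) (rule that)
  obtain lam C1 where C1: "C1 \<ge> 0" "\<And>u. norm u < r / 2 \<Longrightarrow>
      norm (reg u - reg 0 + (\<Sum>l=1..M. lam l * u ^ l)) \<le> C1 * norm u ^ Suc M"
    by (rule holomorphic_Taylor_bound [OF hol r(1)]) (rule that)
  define q where "q u = - 1 / (4 * artanh_quot u)" for u
  have "q holomorphic_on ball 0 r"
    unfolding q_def using A0 r
    by (intro holomorphic_intros holomorphic_on_subset [OF artanh_quot_holomorphic]) auto
  from holomorphic_Taylor_bound [OF this r(1)]
  obtain lam' C2 where C2: "C2 \<ge> 0" "\<And>u. norm u < r / 2 \<Longrightarrow>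
      norm (q u - q 0 + (\<Sum>l=1..M. lam' l * u ^ l)) \<le> C2 * norm u ^ Suc M"
    by metis
  have q0: "q 0 = - 1 / 4"
    by (simp add: q_def artanh_quot_0)
  have "norm (wp k M lam lam' (1 - u)) \<le> (C + C1 + C2) * norm u ^ Suc M"
    if u: "u \<in> wedge" "u \<noteq> 0" "norm u < r / 2" for u
  proof -
    let ?x = "g k (1 - u) - reg u + of_bool (k = 1) * csqrt u * (1 / (4 * artanh_quot u))"
    let ?y = "reg u - reg 0 + (\<Sum>l=1..M. lam l * u ^ l)"
    let ?z = "q u - q 0 + (\<Sum>l=1..M. lam' l * u ^ l)"
    have eq: "wp k M lam lam' (1 - u) = ?x + ?y + of_bool (k = 1) * csqrt u * ?z"
      unfolding wp_def reg0 q0 by (simp add: q_def algebra_simps)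
    have "norm (wp k M lam lam' (1 - u)) \<le> norm ?x + norm ?y + norm (of_bool (k = 1) * csqrt u * ?z)"
      unfolding eq
      using norm_triangle_ineq [of "?x + ?y" "of_bool (k = 1) * csqrt u * ?z"]
        norm_triangle_ineq [of ?x ?y] by linarith
    moreover have "norm (of_bool (k = 1) * csqrt u * ?z) \<le> 1 * norm ?z"
    proof -
      have "(norm (csqrt u))\<^sup>2 \<le> 1\<^sup>2"
        unfolding norm_power [symmetric] power2_csqrt using u r by simp
      then have "norm (csqrt u) \<le> 1"
        by (rule power2_le_imp_le) simp
      then have "norm (of_bool (k = 1) * csqrt u) \<le> 1"
        by (simp add: norm_mult)
      then show ?thesis
        unfolding norm_mult [of "of_bool (k = 1) * csqrt u"] by (rule mult_right_mono) simp
    qed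
    moreover have "norm ?x \<le> C * norm u ^ Suc M"
      using u r by (intro g) auto
    moreover have "norm ?y \<le> C1 * norm u ^ Suc M"
      by (intro C1 u)
    moreover have "norm ?z \<le> C2 * norm u ^ Suc M"
      by (intro C2 u)
    ultimately show ?thesis
      unfolding distrib_right by linarith
  qed
  then show ?thesis
    using r by (intro that [of "r / 2" lam lam' "C + C1 + C2"]) auto
qed

section \<open>Continuation to the closed disc\<close>

text \<open>Locally uniform convergence: on a disc around \<open>q\<close> that stays within norm
  \<open>r < 1\<close>, the terms are dominated by
  \<open>(n + 1)^k * r^(n + 1) / (1 - r)\<close>.\<close>

lemma Lambert_series_holomorphic:
  "(\<lambda>q. \<Sum>n. of_nat (Suc n) ^ k * (q ^ Suc n / (1 - q ^ Suc n))) holomorphic_on ball 0 1"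
proof -
  define f :: "nat \<Rightarrow> complex \<Rightarrow> complex"
    where "f n q = of_nat (Suc n) ^ k * (q ^ Suc n / (1 - q ^ Suc n))" for n q
  have pow: "norm q ^ Suc n \<le> norm q" if "norm q < 1" for q :: complex and n
    using power_decreasing [of 1 "Suc n" "norm q"] that by (simp del: power_Suc)
  have "f n holomorphic_on ball 0 1" for n
  proof -
    have "q ^ Suc n \<noteq> 1" if "norm q < 1" for q :: complex
    proof
      assume "q ^ Suc n = 1"
      then have "norm (q ^ Suc n) = 1"
        by (simp only: norm_one)
      then show False
        using pow [OF that, of n] that unfolding norm_power by linarith
    qed
    then show ?thesis
      unfolding f_def by (intro holomorphic_intros) auto
  qed
  then have der: "(f n has_field_derivative deriv (f n) q) (at q)" if "q \<in> ball 0 1" for n q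
    by (rule holomorphic_derivI) (use that in auto)
  have "\<exists>d h. 0 < d \<and> summable h \<and> (\<forall>\<^sub>F n in sequentially. \<forall>y\<in>ball q d \<inter> ball 0 1. norm (f n y) \<le> h n)"
    if q: "q \<in> ball 0 1" for q
  proof -
    obtain r where r: "norm q < r" "r < 1"
      using q dense [of "norm q" 1] by auto
    then have r0: "r > 0"
      using norm_ge_zero [of q] by linarith
    define h where "h n = of_nat (Suc n) ^ k * r ^ Suc n * (1 / (1 - r))" for n
    have "summable (\<lambda>n. of_nat n ^ k * r ^ n)"
      using r r0 by (intro summable_power_mult_geometric) auto
    then have "summable h"
      unfolding h_def by (intro summable_mult2) (subst summable_Suc_iff)
    moreover have "norm (f n y) \<le> h n" if "y \<in> ball q (r - norm q)" for n y
    proof -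
      have y: "norm y \<le> r"
        using that norm_triangle_ineq2 [of y q] by (simp add: dist_norm norm_minus_commute)
      have "norm y ^ Suc n \<le> norm y"
        using y r by (intro pow) auto
      then have "1 - r \<le> 1 - norm (y ^ Suc n)"
        using y by (simp add: norm_power del: power_Suc)
      also have "\<dots> \<le> norm (1 - y ^ Suc n)"
        using norm_triangle_ineq2 [of 1 "y ^ Suc n"] by simp
      finally have "norm (y ^ Suc n) / norm (1 - y ^ Suc n) \<le> r ^ Suc n / (1 - r)"
        unfolding norm_power using y r r0 by (intro frac_le power_mono) auto
      then have "of_nat (Suc n) ^ k * (norm (y ^ Suc n) / norm (1 - y ^ Suc n))
          \<le> of_nat (Suc n) ^ k * (r ^ Suc n / (1 - r))"
        by (rule mult_left_mono) simp
      then show ?thesis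
        by (simp add: f_def h_def norm_mult norm_divide norm_power del: of_nat_Suc power_Suc)
    qed
    ultimately show ?thesis
      using r by (intro exI [of _ "r - norm q"] exI [of _ h]) auto
  qed
  from series_and_derivative_comparison_local [OF open_ball der this]
  obtain G G' where G: "\<And>q. q \<in> ball 0 1 \<Longrightarrow> (\<lambda>n. f n q) sums G q"
      "\<And>q. q \<in> ball 0 1 \<Longrightarrow> (G has_field_derivative G' q) (at q)"
    by blast
  have "G holomorphic_on ball 0 1"
    unfolding holomorphic_on_open [OF open_ball] using G(2) by blast
  then show ?thesis
    by (rule holomorphic_transform) (use G(1) in \<open>auto simp: sums_iff f_def\<close>)
qed

section \<open>Holomorphy of \<open>g\<close> and \<open>wp\<close> on the slit plane\<close>

definition slit_plane :: "complex set" where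
  "slit_plane = {z. 1 - z \<notin> \<real>\<^sub>\<le>\<^sub>0}"

lemma open_slit_plane: "open slit_plane"
proof -
  have "closed ((\<lambda>z. 1 - z) -` \<real>\<^sub>\<le>\<^sub>0 :: complex set)"
    by (intro closed_vimage continuous_intros closed_nonpos_Reals_complex)
  moreover have "slit_plane = - ((\<lambda>z. 1 - z) -` \<real>\<^sub>\<le>\<^sub>0)"
    by (auto simp: slit_plane_def)
  ultimately show ?thesis
    by (metis open_Compl)
qed

lemma Re_csqrt_pos:
  assumes "z \<notin> \<real>\<^sub>\<le>\<^sub>0"
  shows "0 < Re (csqrt z)"
proof -
  define w where "w = csqrt z"
  have z: "z = w\<^sup>2"
    by (simp add: w_def)
  have "Re w \<noteq> 0"
    using assms unfolding z by (auto simp: complex_nonpos_Reals_iff Re_power2 Im_power2)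
  moreover have "0 < Re w \<or> Re w = 0"
    using csqrt_principal [of z] unfolding w_def by blast
  ultimately show ?thesis
    unfolding w_def by blast
qed

text \<open>\<open>b\<close> is the Cayley transform of \<open>csqrt (1 - z)\<close>; it maps the
  open right half-plane into the unit disc.\<close>

lemma norm_b_less_1:
  assumes "z \<in> slit_plane"
  shows "1 + csqrt (1 - z) \<noteq> 0" "norm (b z) < 1"
proof -
  define w where "w = csqrt (1 - z)"
  have w: "0 < Re w"
    using Re_csqrt_pos [of "1 - z"] assms unfolding slit_plane_def w_def by blast
  then have "0 < Re (1 + w)"
    by simp
  then have nz: "1 + w \<noteq> 0"
    by (metis less_irrefl zero_complex.sel(1))
  then show "1 + csqrt (1 - z) \<noteq> 0"
    by (simp add: w_def)
  have "(norm (1 - w))\<^sup>2 < (norm (1 + w))\<^sup>2"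
    using w unfolding cmod_power2 by (simp add: power2_eq_square algebra_simps)
  then have "norm (1 - w) < norm (1 + w)"
    by (rule power_less_imp_less_base) simp
  then show "norm (b z) < 1"
    using nz by (simp add: b_def norm_divide flip: w_def)
qed

lemma g_holomorphic: "g k holomorphic_on slit_plane"
proof -
  have w: "(\<lambda>z. csqrt (1 - z)) holomorphic_on slit_plane"
    by (intro holomorphic_intros) (auto simp: slit_plane_def)
  then have "b holomorphic_on slit_plane"
    unfolding b_def using norm_b_less_1(1)
    by (intro holomorphic_on_divide holomorphic_on_diff holomorphic_on_add holomorphic_on_const)
  then have "((\<lambda>q. \<Sum>n. of_nat (Suc n) ^ k * (q ^ Suc n / (1 - q ^ Suc n))) \<circ> b) holomorphic_on slit_plane"
    by (rule holomorphic_on_compose_gen [OF _ Lambert_series_holomorphic])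
       (use norm_b_less_1(2) in auto)
  with w show ?thesis
    unfolding g_def o_def by (intro holomorphic_on_mult holomorphic_on_power)
qed

lemma wp_holomorphic: "wp k M lam lam' holomorphic_on slit_plane"
proof -
  have "(\<lambda>z. csqrt (1 - z)) holomorphic_on slit_plane"
    by (intro holomorphic_intros) (auto simp: slit_plane_def)
  with g_holomorphic [of k] show ?thesis
    unfolding wp_def by (intro holomorphic_intros) (auto simp: slit_plane_def)
qed

section \<open>Boundary behaviour on the closed disc\<close>

lemma cball_subset_slit_plane: "cball 0 1 - {1} \<subseteq> slit_plane"
proof
  fix z :: complex assume z: "z \<in> cball 0 1 - {1}"
  show "z \<in> slit_plane"
  proof (rule ccontr)
    assume "z \<notin> slit_plane"
    then have "Re z \<ge> 1" "Im z = 0"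
      by (auto simp: slit_plane_def complex_nonpos_Reals_iff)
    moreover have "Re z \<le> 1"
      using z complex_Re_le_cmod [of z] by simp
    ultimately show False
      using z by (auto simp: complex_eq_iff)
  qed
qed

text \<open>For u = 1 - z one has Re u >= 0, so moving by at most |u|/4 leaves Re (1 - v) >= -|u|/4
  and |1 - v| >= 3|u|/4. This forces the wedge condition and keeps 1 - v off the nonpositive
  reals.\<close>

lemma cball_wedge:
  assumes z: "z \<in> cball 0 1" "z \<noteq> 1" and v: "v \<in> cball z (norm (1 - z) / 4)"
  shows "1 - v \<in> wedge" "v \<noteq> 1" "v \<in> slit_plane" "norm (1 - v) \<le> 2 * norm (1 - z)"
proof -
  define u where "u = 1 - z"
  define e where "e = z - v"
  have u0: "norm u > 0"
    using z by (simp add: u_def)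
  have Reu: "Re u \<ge> 0"
    using z complex_Re_le_cmod [of z] by (simp add: u_def)
  have e: "norm e \<le> norm u / 4"
    using v by (simp add: e_def u_def dist_norm)
  have veq: "1 - v = u + e"
    by (simp add: u_def e_def)
  have "norm (1 - v) \<ge> 3 / 4 * norm u"
    using norm_diff_ineq [of u e] e by (simp add: veq)
  moreover have "Re (1 - v) \<ge> - norm u / 4"
    using abs_Re_le_cmod [of e] Reu e by (simp add: veq)
  ultimately have "- norm (1 - v) / 2 \<le> Re (1 - v)" "0 < norm (1 - v)"
    using u0 by linarith+
  then show "1 - v \<in> wedge" "v \<noteq> 1"
    by (auto simp: wedge_def)
  show "v \<in> slit_plane"
  proof (rule ccontr)
    assume "v \<notin> slit_plane"
    then have "Re (1 - v) \<le> 0" "Im (1 - v) = 0"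
      by (auto simp: slit_plane_def complex_nonpos_Reals_iff)
    then have "norm (1 - v) = - Re (1 - v)"
      by (simp add: cmod_eq_Re)
    then show False
      using \<open>norm (1 - v) \<ge> 3 / 4 * norm u\<close> \<open>Re (1 - v) \<ge> - norm u / 4\<close> u0 by linarith
  qed
  show "norm (1 - v) \<le> 2 * norm (1 - z)"
    unfolding veq u_def [symmetric] using norm_triangle_ineq [of u e] e u0 by linarith
qed

theorem theorem4p1:
  fixes k M :: nat
  assumes "k \<ge> 1" and "M \<ge> 2"
  shows "\<exists>lam lam' :: nat \<Rightarrow> complex.
    wp k M lam lam' holomorphic_on ball 0 1 \<and>
    (\<forall>j\<le>M. \<exists>h :: complex \<Rightarrow> complex.
       continuous_on (cball 0 1) h \<and>
       (\<forall>z\<in>ball 0 1. h z = (deriv ^^ j) (wp k M lam lam') z) \<and>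
       h 1 = 0)"
proof -
  have "k > 0"
    using assms by simp
  then obtain lam lam' C r where r: "0 < r" "r \<le> 1"
    and C: "\<And>u. u \<in> wedge \<Longrightarrow> u \<noteq> 0 \<Longrightarrow> norm u < r \<Longrightarrow>
          norm (wp k M lam lam' (1 - u)) \<le> C * norm u ^ Suc M"
    by (rule wp_near_1) (rule that)
  define P where "P = wp k M lam lam'"
  have hol: "P holomorphic_on slit_plane"
    unfolding P_def by (rule wp_holomorphic)
  have ball: "ball 0 1 \<subseteq> slit_plane"
    using cball_subset_slit_plane by auto
  have "\<exists>h. continuous_on (cball 0 1) h \<and> (\<forall>z\<in>ball 0 1. h z = (deriv ^^ j) P z) \<and> h 1 = 0"
    if j: "j \<le> M" for j
  proof -
    \<comment> \<open>\<open>P\<close> is holomorphic across every boundary point other than 1, so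
      its derivatives are already the continuation there; only the value at 1 is prescribed.\<close>
    define h where "h z = (if z = 1 then 0 else (deriv ^^ j) P z)" for z
    \<comment> \<open>In Cauchy's inequality, 2^(M+1) comes from |1 - v| <= 2 |1 - z| and
      \<open>4 ^ j\<close> from the radius |1 - z| / 4. The same doubling explains the restriction
      to |1 - z| < r/2 below.\<close>
    define D where "D = fact j * (\<bar>C\<bar> * 2 ^ Suc M) * 4 ^ j"
    have bound: "norm (h z) \<le> D * norm (1 - z)"
      if z: "z \<in> cball 0 1" "z \<noteq> 1" "norm (1 - z) < r / 2" for z
    proof -
      define R where "R = norm (1 - z)"
      have R: "0 < R" "R \<le> 1"
        using z r by (auto simp: R_def)
      have sub: "cball z (R / 4) \<subseteq> slit_plane"
        using cball_wedge(3) [OF z(1,2)] by (auto simp: R_def)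
      have "norm ((deriv ^^ j) P z) \<le> fact j * (\<bar>C\<bar> * (2 * R) ^ Suc M) / (R / 4) ^ j"
      proof (rule Cauchy_inequality)
        show "P holomorphic_on ball z (R / 4)"
          using sub ball_subset_cball by (blast intro: holomorphic_on_subset [OF hol])
        show "continuous_on (cball z (R / 4)) P"
          using sub by (blast intro: holomorphic_on_imp_continuous_on holomorphic_on_subset [OF hol])
        fix v assume "norm (z - v) = R / 4"
        then have v: "v \<in> cball z (norm (1 - z) / 4)"
          by (simp add: R_def dist_norm)
        note v = cball_wedge [OF z(1,2) v]
        have "norm (P (1 - (1 - v))) \<le> C * norm (1 - v) ^ Suc M"
          unfolding P_def using v z by (intro C) auto
        also have "\<dots> \<le> \<bar>C\<bar> * (2 * R) ^ Suc M"
          using v(4) by (intro mult_mono power_mono) (auto simp: R_def)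
        finally show "norm (P v) \<le> \<bar>C\<bar> * (2 * R) ^ Suc M"
          by simp
      qed (use R in auto)
      also have "\<dots> = D * (R ^ Suc M / R ^ j)"
        by (simp add: D_def power_mult_distrib power_divide)
      also have "R ^ Suc M / R ^ j = R ^ (Suc M - j)"
        using R j by (simp add: power_diff)
      \<comment> \<open>The order M + 1 of the bound leaves at least one power of \<open>R\<close>
        after \<open>j \<le> M\<close> differentiations, which forces the limit 0 at 1.\<close>
      also have "D * R ^ (Suc M - j) \<le> D * R ^ 1"
        using R j by (intro mult_left_mono power_decreasing) (auto simp: D_def)
      finally show ?thesis
        using z by (simp add: h_def R_def)
    qed
    have "continuous_on (cball 0 1) h"
      unfolding continuous_on_eq_continuous_within
    proof
      fix z :: complex assume z: "z \<in> cball 0 1"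
      show "continuous (at z within cball 0 1) h"
      proof (cases "z = 1")
        case True
        have "(h \<longlongrightarrow> 0) (at 1 within cball 0 1)"
        proof (rule Lim_null_comparison)
          show "\<forall>\<^sub>F z in at 1 within cball 0 1. norm (h z) \<le> D * norm (1 - z)"
            unfolding eventually_at using r bound
            by (intro exI [of _ "r / 2"]) (auto simp: dist_norm norm_minus_commute)
          show "((\<lambda>z. D * norm (1 - z)) \<longlongrightarrow> 0) (at 1 within cball 0 1)"
            by (auto intro!: tendsto_eq_intros)
        qed
        then show ?thesis
          by (simp add: True continuous_within h_def)
      next
        case False
        with z have zs: "z \<in> slit_plane - {1}"
          using cball_subset_slit_plane by auto
        have op: "open (slit_plane - {1})"
          by (intro open_Diff open_slit_plane) auto
        have "h holomorphic_on slit_plane - {1}"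
          by (rule holomorphic_transform [of "(deriv ^^ j) P"])
             (auto simp: h_def intro!: holomorphic_on_subset
                [OF holomorphic_higher_deriv [OF hol open_slit_plane]])
        then have "isCont h z"
          using zs op holomorphic_on_imp_continuous_on continuous_on_eq_continuous_at by blast
        then show ?thesis
          by (rule continuous_at_imp_continuous_at_within)
      qed
    qed
    then show ?thesis
      by (intro exI [of _ h]) (auto simp: h_def)
  qed
  moreover have "P holomorphic_on ball 0 1"
    by (rule holomorphic_on_subset [OF hol ball])
  ultimately show ?thesis
    unfolding P_def by blast
qed

end
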